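(* For every $\tau\in\mathbb{H}^2$ set $$g(\tau)=\frac{\eta^4(\tau)\,\eta^8(6\tau)}{\eta^8(2\tau)\,\eta^4(3\tau)} .$$ Then $$\{g,\tau\}+\frac{81g^4-108g^3+102g^2-12g+1}{2(9g-1)^2(g-1)^2g^2}\,(g')^2=0 .$$
   Context: $\mathbb{H}^2=\{\tau\in\mathbb{C}\mid \Im\tau>0\}$; $\eta(\tau)=e^{2\pi i\tau/24}\prod_{n\ge1}(1-e^{2\pi i n\tau})$ is the Dedekind eta function and $\eta^k(m\tau)=(\eta(m\tau))^k$. The prime denotes $d/d\tau$, and the Schwarzian derivative of $y=y(x)$ is $\{y,x\}=\frac{y'''}{y'}-\frac32\left(\frac{y''}{y'}\right)^2$, derivatives being taken with respect to $x$. *)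

theory Defs
  imports "HOL-Analysis.Analysis"
begin

(* Meaningful for Im t > 0 only.  The library product runs over n = 0, 1, 2, ...,
   hence the shift to Suc n. *)
definition dedekind_eta :: "complex \<Rightarrow> complex" where
  "dedekind_eta t =
     exp (2 * of_real pi * \<i> * t / 24) *
     (\<Prod>n. 1 - exp (2 * of_real pi * \<i> * of_nat (Suc n) * t))"

(* Schwarzian derivative {y, x} at the point x, with complex derivatives.  Where y' vanishes the
   notion is undefined mathematically and the value here is 0 by the convention for division. *)
definition schwarzian :: "(complex \<Rightarrow> complex) \<Rightarrow> complex \<Rightarrow> complex" where
  "schwarzian y x =
     (deriv ^^ 3) y x / deriv y x - 3 / 2 * ((deriv ^^ 2) y x / deriv y x) ^ 2"

end

theory Submission
  imports Defs "HOL-Complex_Analysis.Complex_Analysis"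
begin

text \<open>
  Put \<open>q = exp (2 \<pi> i \<tau>)\<close> and \<open>D = q d/dq\<close>, so that \<open>d/d\<tau> = 2 \<pi> i D\<close>.  The eta quotient \<open>g\<close> is
  \<open>G = q \<psi>(q^3)^4 / \<psi>(q)^4\<close> with Gauss's series \<open>\<psi>(q) = \<Sum>n\<ge>0. q^(n(n+1)/2)\<close>.  It satisfies a
  third-order equation because it belongs to a first-order system that closes up: with
  \<open>\<phi>(-q) = \<Sum>n. (-1)^n q^(n^2)\<close>, the weight-two form \<open>M = \<phi>(-q)^2 \<phi>(-q^3)^2\<close> and the quasimodular
  \<open>B = D log (q^(1/4) \<psi>(q)^2)\<close>,

    \<open>DG = G M\<close>,
    \<open>DM = M (2 B - M (1/2 + G/(1-G) + 9G/(1-9G)))\<close>,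
    \<open>DB = B^2 - M^2 (1-9G) / (16 (1-G))\<close>.

  Writing \<open>DDG = (DG) Y\<close>, the Schwarzian with respect to \<open>D\<close> is \<open>DY - Y^2/2\<close>; there \<open>B\<close> cancels and a
  rational function of \<open>G\<close> times \<open>M^2\<close> remains, which is the asserted one
  (lemma \<open>hauptmodul_schwarzian\<close>).

  The system is obtained without the theory of modular forms.  By the Jacobi triple product, \<open>\<psi>\<close>,
  \<open>\<phi>\<close> and the two series \<open>a\<close> and \<open>b\<close> that arise when their exponents are sorted modulo 3 are quotients of Euler
  products.  Multiplying the trisections
  \<open>\<psi>(q) = a(q^3) + q \<psi>(q^9)\<close> and \<open>\<phi>(-q) = \<phi>(-q^9) - 2 q b(q^3)\<close> over the three cube roots of the nome gives
  product formulas for \<open>1 - G\<close> and \<open>1 - 9G\<close>.  So \<open>G\<close> avoids the values 1 and 1/9, and \<open>M^2\<close> is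
  \<open>q \<psi>(q)^8\<close> times a rational function of \<open>G\<close>, which yields \<open>DM\<close> from \<open>DG\<close>.

  The equations for \<open>DG\<close> and \<open>DB\<close> rest on self-similarity under \<open>q \<mapsto> q^3\<close>.  The trisections express
  \<open>G(q)\<close>, \<open>G(q^3)\<close> and \<open>M(q)/M(q^3)\<close> rationally in one parameter, and differentiating shows that
  \<open>(DG/G)/M\<close> takes the same value at \<open>q\<close> and \<open>q^3\<close>; iterating, \<open>q^(3^n)\<close> tends to 0, where the
  quotient is 1.  In the same way the defect \<open>E\<close> of the equation for \<open>DB\<close> satisfies \<open>E(q) = 9 E(q^3)\<close>
  and \<open>E(0) = 0\<close>, and the tripled exponents beat the factors 9, so \<open>E = 0\<close>.
\<close>

section \<open>The finite triple product\<close>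

definition q_fact :: "complex \<Rightarrow> nat \<Rightarrow> complex" where
  "q_fact q n = (\<Prod>k<n. 1 - q ^ Suc k)"

definition q_binomial :: "complex \<Rightarrow> nat \<Rightarrow> nat \<Rightarrow> complex" where
  "q_binomial q m j = (if j \<le> m then q_fact q m / (q_fact q j * q_fact q (m - j)) else 0)"

text \<open>Ramanujan's normalisation of the theta series.  Both exponents are nonnegative for every integer
  \<open>n\<close>, so no negative powers occur and \<open>a\<close> or \<open>b\<close> may vanish.\<close>

definition theta_term :: "complex \<Rightarrow> complex \<Rightarrow> int \<Rightarrow> complex" where
  "theta_term a b n = a ^ nat (n * (n + 1) div 2) * b ^ nat (n * (n - 1) div 2)"

lemma one_minus_power_nonzero:
  fixes q :: complex
  assumes "norm q < 1"
  shows "1 - q ^ Suc k \<noteq> 0"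
proof
  assume "1 - q ^ Suc k = 0"
  hence "norm (q ^ Suc k) = 1" by (metis eq_iff_diff_eq_0 norm_one)
  thus False using assms power_less_one_iff[of "norm q" "Suc k"]
    by (auto simp: norm_power power_less_one_iff simp del: power_Suc)
qed

lemma q_fact_0 [simp]: "q_fact q 0 = 1"
  by (simp add: q_fact_def)

lemma q_fact_Suc: "q_fact q (Suc n) = q_fact q n * (1 - q ^ Suc n)"
  by (simp add: q_fact_def)

lemma q_fact_nonzero: "norm q < 1 \<Longrightarrow> q_fact q n \<noteq> 0"
  using one_minus_power_nonzero by (auto simp: q_fact_def simp del: power_Suc)

lemma q_binomial_edges [simp]:
  assumes "norm q < 1"
  shows "q_binomial q m 0 = 1" "q_binomial q m m = 1" "j > m \<Longrightarrow> q_binomial q m j = 0"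
  using q_fact_nonzero[OF assms] by (auto simp: q_binomial_def)

text \<open>Both recursions come from splitting \<open>1 - q^(m+1)\<close>, as \<open>(1 - q^(m-j)) + q^(m-j) (1 - q^(j+1))\<close> or
  as \<open>(1 - q^(j+1)) + q^(j+1) (1 - q^(m-j))\<close>.  They are used to append one factor at either end of the
  finite triple product.\<close>

lemma q_pascal:
  assumes q: "norm q < 1" and j: "j \<le> m"
  shows "q_binomial q (Suc m) (Suc j) = q_binomial q m (Suc j) + q ^ (m - j) * q_binomial q m j"
    and "q_binomial q (Suc m) (Suc j) = q ^ Suc j * q_binomial q m (Suc j) + q_binomial q m j"
proof -
  consider "j = m" | d where "m = Suc (j + d)"
    using j by (metis add_Suc_right le_eq_less_or_eq less_imp_Suc_add)
  hence "q_binomial q (Suc m) (Suc j) = q_binomial q m (Suc j) + q ^ (m - j) * q_binomial q m j \<and>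
         q_binomial q (Suc m) (Suc j) = q ^ Suc j * q_binomial q m (Suc j) + q_binomial q m j"
  proof cases
    case 1
    thus ?thesis using q by simp
  next
    case (2 d)
    define x y where "x = q ^ Suc j" and "y = q ^ Suc d"
    define u v w where "u = q_fact q j" and "v = q_fact q d" and "w = q_fact q m"
    have nz: "1 - x \<noteq> 0" "1 - y \<noteq> 0" "u \<noteq> 0" "v \<noteq> 0"
      using q one_minus_power_nonzero[OF q] q_fact_nonzero[OF q]
      by (auto simp: x_def y_def u_def v_def simp del: power_Suc)
    have f: "q_fact q (Suc j) = u * (1 - x)" "q_fact q (Suc d) = v * (1 - y)"
            "q_fact q (Suc m) = w * (1 - x * y)"
      by (auto simp: q_fact_Suc u_def v_def w_def x_def y_def 2 simp flip: power_add)
    have e: "q_binomial q (Suc m) (Suc j) = w * (1 - x * y) / (u * (1 - x) * (v * (1 - y)))"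
            "q_binomial q m (Suc j) = w / (u * (1 - x) * v)"
            "q_binomial q m j = w / (u * (v * (1 - y)))"
            "q ^ (m - j) = y"
    proof -
      have ix: "Suc m - Suc j = Suc d" "m - Suc j = d" "m - j = Suc d" using 2 by auto
      have le: "Suc j \<le> m" using 2 by simp
      show "q_binomial q (Suc m) (Suc j) = w * (1 - x * y) / (u * (1 - x) * (v * (1 - y)))"
           "q_binomial q m (Suc j) = w / (u * (1 - x) * v)"
           "q_binomial q m j = w / (u * (v * (1 - y)))"
           "q ^ (m - j) = y"
        unfolding q_binomial_def ix f using le j
        by (simp_all add: w_def u_def v_def f[unfolded u_def v_def] y_def)
    qed
    show ?thesis unfolding e x_def[symmetric] using nz
      by (auto simp: divide_simps) (auto simp: algebra_simps)?
  qed
  thus "q_binomial q (Suc m) (Suc j) = q_binomial q m (Suc j) + q ^ (m - j) * q_binomial q m j"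
    and "q_binomial q (Suc m) (Suc j) = q ^ Suc j * q_binomial q m (Suc j) + q_binomial q m j"
    by auto
qed

lemma int_triangle_nonneg: "(0::int) \<le> n * (n + 1) div 2" "(0::int) \<le> n * (n - 1) div 2"
proof -
  have "0 \<le> n * (n + 1)" "0 \<le> n * (n - 1)"
    by (cases "n \<ge> 0"; cases "n \<ge> 1"; auto simp: zero_le_mult_iff)+
  thus "0 \<le> n * (n + 1) div 2" "0 \<le> n * (n - 1) div 2" by auto
qed

lemma int_triangle_step: "(n + 1) * (n + 2) div 2 = n * (n + 1) div 2 + (n + 1 :: int)"
proof -
  have "(n + 1) * (n + 2) = n * (n + 1) + (n + 1) * 2" by (simp add: algebra_simps)
  thus ?thesis by (metis div_mult_self1 add.commute mult.commute zero_neq_numeral)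
qed

text \<open>The effect on one term of the factor \<open>a (ab)^M\<close> that enters with a new member of the finite
  product: the index moves up by one, and the power of \<open>ab\<close> that is left over is the one in
  Pascal's rule.\<close>

lemma theta_term_up:
  assumes "n \<le> int M"
  shows "a * (a * b) ^ M * theta_term a b n = (a * b) ^ nat (int M - n) * theta_term a b (n + 1)"
proof -
  define u v where "u = n * (n + 1) div 2" and "v = n * (n - 1) div 2"
  have u: "u \<ge> 0" and v: "v \<ge> 0" using int_triangle_nonneg by (auto simp: u_def v_def)
  have uv: "u = v + n"
    using int_triangle_step[of "n - 1"] by (simp add: u_def v_def algebra_simps)
  have w: "(n + 1) * (n + 1 + 1) div 2 = u + n + 1"
    using int_triangle_step[of n] by (simp add: u_def algebra_simps)
  have w0: "u + n + 1 \<ge> 0" using int_triangle_nonneg(1)[of "n+1"] unfolding w by simp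
  have s: "(n + 1) * (n + 1 - 1) div 2 = u" by (simp add: u_def algebra_simps)
  have e1: "Suc (M + nat u) = nat (int M - n) + nat (u + n + 1)"
    using assms u w0 by linarith
  have e2: "M + nat v = nat (int M - n) + nat u"
    using assms u v uv by linarith
  have "a * (a * b) ^ M * theta_term a b n = a ^ Suc (M + nat u) * b ^ (M + nat v)"
    by (simp add: theta_term_def power_add power_mult_distrib u_def v_def)
  also have "\<dots> = (a * b) ^ nat (int M - n) * theta_term a b (n + 1)"
    unfolding e1 e2 theta_term_def w s by (simp add: power_add power_mult_distrib)
  finally show ?thesis .
qed

lemma theta_term_reflect: "theta_term a b (- n) = theta_term b a n"
  by (simp add: theta_term_def algebra_simps)

lemma theta_term_down:
  assumes "- int N \<le> n"
  shows "b * (a * b) ^ N * theta_term a b n = (a * b) ^ nat (int N + n) * theta_term a b (n - 1)"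
  using theta_term_up[of "- n" N b a] theta_term_reflect[of b a n] theta_term_reflect[of b a "n - 1"]
  using assms by (simp add: mult.commute)

text \<open>Induction on the two numbers of factors separately; keeping them independent means that each step
  is a single application of one of the Pascal rules.\<close>

theorem finite_triple_product:
  assumes q: "norm (a * b) < 1"
  shows "(\<Prod>k<M. 1 + a * (a * b) ^ k) * (\<Prod>k<N. 1 + b * (a * b) ^ k) =
         (\<Sum>j\<le>M + N. q_binomial (a * b) (M + N) j * theta_term a b (int j - int N))"
proof (induction M)
  case 0
  show ?case
  proof (induction N)
    case 0
    thus ?case using q by (simp add: theta_term_def)
  next
    case (Suc N)
    define c where "c = q_binomial (a * b)"
    define t where "t j = theta_term a b (int j - int (Suc N))" for j
    have t: "theta_term a b (int j - int N) = t (Suc j)"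
            "b * (a * b) ^ N * theta_term a b (int j - int N) = (a * b) ^ j * t j" for j
      using theta_term_down[of N "int j - int N" b a] by (auto simp: t_def algebra_simps)
    have "(\<Prod>k<0. 1 + a * (a * b) ^ k) * (\<Prod>k<Suc N. 1 + b * (a * b) ^ k) =
          (\<Sum>j\<le>N. c N j * theta_term a b (int j - int N)) * (1 + b * (a * b) ^ N)"
      using Suc by (simp add: c_def)
    also have "\<dots> = (\<Sum>j\<le>N. c N j * t (Suc j)) + (\<Sum>j\<le>N. c N j * ((a * b) ^ j * t j))"
      unfolding distrib_left sum_distrib_right t(2)[symmetric]
      by (simp add: t(1)[symmetric] algebra_simps)
    also have "(\<Sum>j\<le>N. c N j * ((a * b) ^ j * t j)) = (\<Sum>j\<le>Suc N. c N j * ((a * b) ^ j * t j))"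
      using q by (simp add: c_def)
    also have "\<dots> = t 0 + (\<Sum>j\<le>N. c N (Suc j) * ((a * b) ^ Suc j * t (Suc j)))"
      using q by (subst sum.atMost_Suc_shift) (simp add: c_def)
    also have "(\<Sum>j\<le>N. c N j * t (Suc j)) + (t 0 + (\<Sum>j\<le>N. c N (Suc j) * ((a * b) ^ Suc j * t (Suc j))))
        = t 0 + (\<Sum>j\<le>N. ((a * b) ^ Suc j * c N (Suc j) + c N j) * t (Suc j))"
      by (simp add: sum.distrib[symmetric] algebra_simps)
    also have "\<dots> = t 0 + (\<Sum>j\<le>N. c (Suc N) (Suc j) * t (Suc j))"
      using q_pascal(2)[OF q] by (simp add: c_def)
    also have "\<dots> = (\<Sum>j\<le>Suc N. c (Suc N) j * t j)"
      using q by (subst sum.atMost_Suc_shift) (simp add: c_def)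
    finally show ?case by (simp add: c_def t_def)
  qed
next
  case (Suc M)
  define m where "m = M + N"
  define c where "c = q_binomial (a * b)"
  define t where "t j = theta_term a b (int j - int N)" for j
  have t: "a * (a * b) ^ M * t j = (a * b) ^ (m - j) * t (Suc j)" if "j \<le> m" for j
  proof -
    have "nat (int M - (int j - int N)) = m - j" using that by (simp add: m_def)
    thus ?thesis
      using theta_term_up[of "int j - int N" M a b] that by (simp add: t_def m_def algebra_simps)
  qed
  have "(\<Prod>k<Suc M. 1 + a * (a * b) ^ k) * (\<Prod>k<N. 1 + b * (a * b) ^ k) =
        (\<Sum>j\<le>m. c m j * t j) * (1 + a * (a * b) ^ M)"
    using Suc by (simp add: c_def t_def m_def algebra_simps)
  also have "\<dots> = (\<Sum>j\<le>m. c m j * t j) + (\<Sum>j\<le>m. c m j * (a * (a * b) ^ M * t j))"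
    by (simp add: distrib_left sum_distrib_left algebra_simps)
  also have "(\<Sum>j\<le>m. c m j * (a * (a * b) ^ M * t j)) =
             (\<Sum>j\<le>m. (a * b) ^ (m - j) * c m j * t (Suc j))"
    using t by (intro sum.cong) (auto simp: algebra_simps)
  also have "(\<Sum>j\<le>m. c m j * t j) = (\<Sum>j\<le>Suc m. c m j * t j)"
    using q by (simp add: c_def)
  also have "\<dots> = t 0 + (\<Sum>j\<le>m. c m (Suc j) * t (Suc j))"
    using q by (subst sum.atMost_Suc_shift) (simp add: c_def)
  also have "t 0 + (\<Sum>j\<le>m. c m (Suc j) * t (Suc j)) + (\<Sum>j\<le>m. (a * b) ^ (m - j) * c m j * t (Suc j))
      = t 0 + (\<Sum>j\<le>m. (c m (Suc j) + (a * b) ^ (m - j) * c m j) * t (Suc j))"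
    by (simp add: sum.distrib[symmetric] algebra_simps)
  also have "\<dots> = t 0 + (\<Sum>j\<le>m. c (Suc m) (Suc j) * t (Suc j))"
    using q_pascal(1)[OF q] by (simp add: c_def)
  also have "\<dots> = (\<Sum>j\<le>Suc m. c (Suc m) j * t j)"
    using q by (subst sum.atMost_Suc_shift) (simp add: c_def)
  finally show ?case by (simp add: c_def t_def m_def)
qed

section \<open>The Euler product and the Jacobi triple product\<close>

definition euler_prod :: "complex \<Rightarrow> complex" where
  "euler_prod q = (\<Prod>n. 1 - q ^ Suc n)"

definition ramanujan_theta :: "complex \<Rightarrow> complex \<Rightarrow> complex" where
  "ramanujan_theta a b = (\<Sum>\<^sub>\<infinity>n. theta_term a b n)"

lemma convergent_euler_prod:
  fixes q :: complex
  assumes "norm q < 1"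
  shows "convergent_prod (\<lambda>n. 1 - q ^ Suc n)"
proof -
  have "summable (\<lambda>n. norm q ^ Suc n)"
    using assms by (simp add: summable_geometric summable_Suc_iff del: power_Suc)
  hence "summable (\<lambda>n. norm ((1 - q ^ Suc n) - 1))" by (simp add: norm_power del: power_Suc)
  thus ?thesis
    by (intro abs_convergent_prod_imp_convergent_prod summable_imp_abs_convergent_prod)
qed

lemma q_fact_tendsto:
  assumes "norm q < 1"
  shows "q_fact q \<longlonglongrightarrow> euler_prod q"
proof -
  have "(\<lambda>n. \<Prod>k\<le>n. 1 - q ^ Suc k) \<longlonglongrightarrow> euler_prod q"
    unfolding euler_prod_def by (rule convergent_prod_LIMSEQ[OF convergent_euler_prod[OF assms]])
  hence "(\<lambda>n. q_fact q (Suc n)) \<longlonglongrightarrow> euler_prod q"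
    unfolding q_fact_def lessThan_Suc_atMost .
  thus ?thesis by (rule LIMSEQ_imp_Suc)
qed

lemma euler_prod_nonzero:
  assumes "norm q < 1"
  shows "euler_prod q \<noteq> 0"
  unfolding euler_prod_def
  by (rule prodinf_nonzero[OF convergent_euler_prod[OF assms]]) (rule one_minus_power_nonzero[OF assms])

lemma euler_prod_0 [simp]: "euler_prod 0 = 1"
  by (simp add: euler_prod_def)

lemma euler_prod_holomorphic: "euler_prod holomorphic_on ball 0 1"
proof (rule holomorphic_uniform_sequence)
  show "(\<lambda>q. q_fact q n) holomorphic_on ball 0 1" for n
    unfolding q_fact_def by (intro holomorphic_intros)
  fix x :: complex
  assume x: "x \<in> ball 0 1"
  define d where "d = (1 - norm x) / 2"
  define r where "r = (1 + norm x) / 2"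
  have d: "d > 0" "r < 1" "r \<ge> 0" "norm x + d = r" using x by (auto simp: d_def r_def field_simps)
  have nr: "norm y \<le> r" if "y \<in> cball x d" for y
  proof -
    have "norm y \<le> norm x + norm (y - x)" by norm
    also have "\<dots> \<le> r" using that d by (auto simp: dist_norm norm_minus_commute)
    finally show ?thesis .
  qed
  have "uniformly_convergent_on (cball x d) (\<lambda>N y. \<Sum>n<N. norm (- (y ^ Suc n)))"
  proof (rule Weierstrass_m_test')
    show "norm (norm (- (y ^ Suc n))) \<le> r ^ Suc n" if "y \<in> cball x d" for n y
      using nr[OF that] by (auto simp: norm_power simp del: power_Suc intro!: power_mono)
    show "summable (\<lambda>n. r ^ Suc n)"
      using d by (simp add: summable_geometric summable_Suc_iff del: power_Suc)
  qed
  hence "uniformly_convergent_on (cball x d) (\<lambda>N y. \<Prod>n<N. 1 + - (y ^ Suc n))"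
    by (intro uniformly_convergent_on_prod) (auto intro!: continuous_intros)
  hence "uniformly_convergent_on (cball x d) (\<lambda>N y. q_fact y N)"
    by (simp add: q_fact_def del: power_Suc)
  hence ul: "uniform_limit (cball x d) (\<lambda>N y. q_fact y N) (\<lambda>y. lim (\<lambda>N. q_fact y N)) sequentially"
    by (simp add: uniformly_convergent_uniform_limit_iff)
  have lim: "lim (\<lambda>N. q_fact y N) = euler_prod y" if "y \<in> cball x d" for y
    using q_fact_tendsto[of y] nr[OF that] d by (intro limI) auto
  have "uniform_limit (cball x d) (\<lambda>N y. q_fact y N) euler_prod sequentially"
    by (rule uniform_limit_cong'[THEN iffD1, OF _ _ ul]) (use lim in auto)
  moreover have "cball x d \<subseteq> ball 0 1" using nr d by force
  ultimately show "\<exists>d>0. cball x d \<subseteq> ball 0 1 \<and>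
      uniform_limit (cball x d) (\<lambda>n q. q_fact q n) euler_prod sequentially"
    using d by blast
qed auto

text \<open>Transport of Tannery's theorem from \<open>nat\<close> to \<open>int\<close> along the bijection \<open>int_decode\<close>.\<close>

lemma tannery_int:
  fixes f :: "nat \<Rightarrow> int \<Rightarrow> complex"
  assumes lim: "\<And>n. (\<lambda>N. f N n) \<longlonglongrightarrow> g n"
    and bound: "\<And>N n. norm (f N n) \<le> h n" and h: "h summable_on UNIV"
  shows "(\<lambda>N. \<Sum>\<^sub>\<infinity>n. f N n) \<longlonglongrightarrow> (\<Sum>\<^sub>\<infinity>n. g n)"
proof -
  have conv: "(\<Sum>\<^sub>\<infinity>n. u n) = (\<Sum>k. u (int_decode k))" if "summable (\<lambda>k. norm (u (int_decode k)))"
    for u :: "int \<Rightarrow> complex"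
  proof -
    have "(\<Sum>\<^sub>\<infinity>n. u n) = (\<Sum>\<^sub>\<infinity>k. u (int_decode k))"
      by (rule infsum_reindex_bij_betw[OF bij_int_decode, symmetric])
    also have "\<dots> = (\<Sum>k. u (int_decode k))"
      using norm_summable_imp_has_sum[OF that summable_sums[OF summable_norm_cancel[OF that]]]
      by (rule infsumI)
    finally show ?thesis .
  qed
  have "(\<lambda>k. h (int_decode k)) summable_on UNIV"
    using h by (simp add: summable_on_reindex_bij_betw[OF bij_int_decode])
  hence hs: "summable (\<lambda>k. h (int_decode k))" by (rule summable_on_imp_summable)
  have T: "eventually (\<lambda>N. summable (\<lambda>k. norm (f N (int_decode k)))) sequentially \<and>
           summable (\<lambda>k. norm (g (int_decode k))) \<and>
           ((\<lambda>N. suminf (\<lambda>k. f N (int_decode k))) \<longlonglongrightarrow> suminf (\<lambda>k. g (int_decode k)))"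
    by (rule tannerys_theorem[where M = "\<lambda>k. h (int_decode k)"])
       (use lim bound hs in \<open>auto intro!: always_eventually\<close>)
  have "summable (\<lambda>k. norm (f N (int_decode k)))" for N
    by (rule summable_comparison_test'[OF hs, of 0]) (use bound in auto)
  thus ?thesis using T by (simp add: conv)
qed

text \<open>The quadratic exponent of \<open>b\<close> is at least \<open>\<bar>n\<bar> - 1\<close>; it vanishes at both \<open>n = 0\<close> and \<open>n = 1\<close>,
  whence the shift.\<close>

lemma theta_term_bound:
  assumes "norm a \<le> 1" "norm b \<le> 1"
  shows "norm (theta_term a b n) \<le> norm b ^ (nat \<bar>n\<bar> - 1)"
proof -
  have "int (nat \<bar>n\<bar> - 1) \<le> n * (n - 1) div 2"
  proof (cases "n \<ge> 1")
    case True
    have "(n - 1) * 2 \<le> n * (n - 1)"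
    proof (cases "n = 1")
      case False
      hence "2 \<le> n" using True by simp
      hence "(n - 1) * 2 \<le> (n - 1) * n" by (intro mult_left_mono) auto
      thus ?thesis by (simp add: mult.commute)
    qed auto
    from zdiv_mono1[OF this, of 2] show ?thesis using True by simp
  next
    case False
    have "(- n - 1) * 2 \<le> (- n) * (1 - n)"
    proof (cases "n \<le> - 1")
      case True
      have "(- n) * 2 \<le> (-n) * (1 - n)" using True by (intro mult_left_mono) auto
      thus ?thesis by (simp add: algebra_simps)
    next
      case False
      with \<open>\<not> n \<ge> 1\<close> have "n = 0" by simp
      thus ?thesis by simp
    qed
    also have "(- n) * (1 - n) = n * (n - 1)" by (simp add: algebra_simps)
    finally have "- n - 1 \<le> n * (n - 1) div 2" using zdiv_mono1[of "(- n - 1) * 2" "n * (n - 1)" 2] by simp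
    moreover have "int (nat \<bar>n\<bar> - 1) = max 0 (- n - 1)" using False by auto
    ultimately show ?thesis using int_triangle_nonneg(2)[of n] by simp
  qed
  hence "nat \<bar>n\<bar> - 1 \<le> nat (n * (n - 1) div 2)" by linarith
  hence "norm b ^ nat (n * (n - 1) div 2) \<le> norm b ^ (nat \<bar>n\<bar> - 1)"
    using assms by (intro power_decreasing) auto
  moreover have "norm a ^ nat (n * (n + 1) div 2) \<le> 1"
    using assms by (intro power_le_one) auto
  ultimately have "norm a ^ nat (n * (n + 1) div 2) * norm b ^ nat (n * (n - 1) div 2)
      \<le> 1 * norm b ^ (nat \<bar>n\<bar> - 1)" by (intro mult_mono) auto
  thus ?thesis by (simp add: theta_term_def norm_mult norm_power)
qed

lemma summable_on_power_abs:
  fixes r :: real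
  assumes "0 \<le> r" "r < 1"
  shows "(\<lambda>n::int. r ^ (nat \<bar>n\<bar> - 1)) summable_on UNIV"
proof -
  have "summable (\<lambda>n. r ^ (Suc n - 1))" using assms by (simp add: summable_geometric)
  hence s: "summable (\<lambda>n. r ^ (n - 1))" by (subst (asm) summable_Suc_iff)
  have s: "(\<lambda>n. r ^ (n - 1)) summable_on (UNIV :: nat set)"
    using assms s by (intro summable_nonneg_imp_summable_on) auto
  have "(\<lambda>n::int. r ^ (nat \<bar>n\<bar> - 1)) summable_on range int"
       "(\<lambda>n::int. r ^ (nat \<bar>n\<bar> - 1)) summable_on range (\<lambda>n. - int n)"
    using s by (simp_all add: summable_on_reindex o_def inj_def)
  hence "(\<lambda>n::int. r ^ (nat \<bar>n\<bar> - 1)) summable_on (range int \<union> range (\<lambda>n. - int n))"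
    by (rule summable_on_union)
  also have "range int \<union> range (\<lambda>n. - int n) = UNIV"
  proof (intro set_eqI iffI UNIV_I)
    show "n \<in> range int \<union> range (\<lambda>n. - int n)" for n :: int
      by (cases n rule: int_cases2) auto
  qed
  finally show ?thesis .
qed

lemma theta_term_summable:
  assumes "norm a \<le> 1" "norm b < 1"
  shows "theta_term a b summable_on UNIV"
proof (rule abs_summable_summable)
  show "(\<lambda>n. norm (theta_term a b n)) summable_on UNIV"
    by (rule summable_on_comparison_test[OF summable_on_power_abs[of "norm b"]])
       (use assms theta_term_bound in auto)
qed

text \<open>After multiplication by \<open>(1-q) \<dots> (1-q^N)\<close>, \<open>q = ab\<close>, the coefficients of the finite triple product
  tend to 1 and are uniformly bounded, so that the limit may be taken term by term.  The case
  \<open>norm a = 1\<close> is needed for \<open>\<psi>\<close>, where \<open>a = 1\<close>.\<close>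

theorem jacobi_triple_product:
  assumes a: "norm a \<le> 1" and b: "norm b < 1"
  shows "(\<lambda>N. \<Prod>k<N. (1 + a * (a * b) ^ k) * (1 + b * (a * b) ^ k) * (1 - (a * b) ^ Suc k))
           \<longlonglongrightarrow> ramanujan_theta a b"
proof -
  define q where "q = a * b"
  have q: "norm q < 1"
    using a b mult_left_le_one_le[of "norm b" "norm a"] by (simp add: q_def norm_mult)
  \<comment> \<open>The finite sum, extended by 0 to all integers so that Tannery applies.\<close>
  define f where "f N n = (if n \<in> {- int N..int N}
      then q_fact q N * q_binomial q (N + N) (nat (int N + n)) * theta_term a b n else 0)" for N n
  have lim_q: "(\<lambda>N. q_fact q (\<phi> N)) \<longlonglongrightarrow> euler_prod q" if "filterlim \<phi> at_top sequentially" for \<phi>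
    using filterlim_compose[OF q_fact_tendsto[OF q] that] .
  have shift: "filterlim (\<lambda>N. nat (int N + n)) at_top sequentially" for n
    unfolding filterlim_at_top
  proof
    fix Z
    show "eventually (\<lambda>N. Z \<le> nat (int N + n)) sequentially"
      using eventually_ge_at_top[of "nat (int Z + \<bar>n\<bar>)"] by eventually_elim linarith
  qed
  have dbl: "filterlim (\<lambda>N::nat. N + N) at_top sequentially"
    unfolding filterlim_at_top
  proof
    fix Z :: nat
    show "eventually (\<lambda>N. Z \<le> N + N) sequentially"
      using eventually_ge_at_top[of Z] by eventually_elim linarith
  qed
  note P = euler_prod_nonzero[OF q]
  have f_eq: "f N n = q_fact q N * (q_fact q (N + N) / (q_fact q (nat (int N + n)) *
       q_fact q (nat (int N + (- n))))) * theta_term a b n" if "\<bar>n\<bar> \<le> int N" for N n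
  proof -
    have "nat (int N + n) \<le> N + N" "N + N - nat (int N + n) = nat (int N + (- n))"
         "n \<in> {- int N..int N}"
      using that by (auto simp: abs_le_iff)
    thus ?thesis by (simp add: f_def q_binomial_def)
  qed
  have lim: "(\<lambda>N. f N n) \<longlonglongrightarrow> theta_term a b n" for n
  proof (rule Lim_transform_eventually)
    have "(\<lambda>N. q_fact q N * (q_fact q (N + N) / (q_fact q (nat (int N + n)) *
              q_fact q (nat (int N + (- n))))) * theta_term a b n)
          \<longlonglongrightarrow> euler_prod q * (euler_prod q / (euler_prod q * euler_prod q)) * theta_term a b n"
      using P by (intro tendsto_intros lim_q shift dbl q_fact_tendsto q) auto
    thus "(\<lambda>N. q_fact q N * (q_fact q (N + N) / (q_fact q (nat (int N + n)) *
              q_fact q (nat (int N + (- n))))) * theta_term a b n) \<longlonglongrightarrow> theta_term a b n"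
      using P by simp
    show "eventually (\<lambda>N. q_fact q N * (q_fact q (N + N) / (q_fact q (nat (int N + n)) *
              q_fact q (nat (int N + (- n))))) * theta_term a b n = f N n) sequentially"
      using eventually_ge_at_top[of "nat \<bar>n\<bar>"] by eventually_elim (simp add: f_eq)
  qed
  obtain C where C: "C > 0" "\<And>n. norm (q_fact q n) \<le> C"
    using q_fact_tendsto[OF q] convergentI convergent_imp_Bseq BseqE by metis
  have "(\<lambda>n. inverse (q_fact q n)) \<longlonglongrightarrow> inverse (euler_prod q)"
    by (intro tendsto_intros q_fact_tendsto q P)
  then obtain C' where C': "C' > 0" "\<And>n. norm (inverse (q_fact q n)) \<le> C'"
    using convergentI convergent_imp_Bseq BseqE by metis
  have bound: "norm (f N n) \<le> C * (C * (C' * C')) * norm b ^ (nat \<bar>n\<bar> - 1)" for N n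
  proof (cases "\<bar>n\<bar> \<le> int N")
    case True
    have "norm (f N n) = norm (q_fact q N) * (norm (q_fact q (N + N)) *
        (norm (inverse (q_fact q (nat (int N + n)))) * norm (inverse (q_fact q (nat (int N + (- n)))))))
        * norm (theta_term a b n)"
      unfolding f_eq[OF True] by (simp add: norm_mult norm_divide norm_inverse divide_simps)
    also have "\<dots> \<le> C * (C * (C' * C')) * norm b ^ (nat \<bar>n\<bar> - 1)"
      using C C' theta_term_bound[of a b n] a b
      by (intro mult_mono mult_nonneg_nonneg norm_ge_zero) auto
    finally show ?thesis .
  next
    case False
    hence "f N n = 0" by (auto simp: f_def)
    thus ?thesis using C C' by simp
  qed
  have "(\<lambda>N. \<Sum>\<^sub>\<infinity>n. f N n) \<longlonglongrightarrow> (\<Sum>\<^sub>\<infinity>n. theta_term a b n)"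
    by (rule tannery_int[OF lim bound])
       (intro summable_on_cmult_right summable_on_power_abs; use b in simp)
  moreover have "(\<Sum>\<^sub>\<infinity>n. f N n) =
      (\<Prod>k<N. (1 + a * (a * b) ^ k) * (1 + b * (a * b) ^ k) * (1 - (a * b) ^ Suc k))" for N
  proof -
    have "(\<Sum>\<^sub>\<infinity>n. f N n) = (\<Sum>\<^sub>\<infinity>n\<in>{- int N..int N}. f N n)"
      by (rule infsum_cong_neutral) (auto simp: f_def)
    also have "\<dots> = (\<Sum>n\<in>{- int N..int N}. f N n)" by simp
    also have "\<dots> = (\<Sum>j\<le>N + N. f N (int j - int N))"
      by (rule sum.reindex_bij_witness[of _ "\<lambda>j. int j - int N" "\<lambda>n. nat (n + int N)"]) auto
    also have "\<dots> = (\<Sum>j\<le>N + N. q_fact q N * (q_binomial q (N + N) j * theta_term a b (int j - int N)))"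
      by (intro sum.cong) (auto simp: f_def)
    also have "\<dots> = q_fact q N * ((\<Prod>k<N. 1 + a * q ^ k) * (\<Prod>k<N. 1 + b * q ^ k))"
      using finite_triple_product[of a b N N] q by (simp add: sum_distrib_left[symmetric] q_def)
    finally show ?thesis by (simp add: q_fact_def q_def prod.distrib mult_ac)
  qed
  ultimately show ?thesis by (simp add: ramanujan_theta_def)
qed

section \<open>Theta series as quotients of Euler products\<close>

text \<open>Gauss's \<open>\<psi>(q)\<close>.  Here and in the next three definitions the product side is taken as the
  definition, since nonvanishing and holomorphy are evident from it; the series are recovered from
  the triple product.\<close>

definition gauss_psi :: "complex \<Rightarrow> complex" where
  "gauss_psi q = euler_prod (q\<^sup>2) ^ 2 / euler_prod q"

text \<open>Gauss's \<open>\<phi>(-q)\<close>, with the sign of the argument absorbed.\<close>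

definition gauss_phi :: "complex \<Rightarrow> complex" where
  "gauss_phi q = euler_prod q ^ 2 / euler_prod (q\<^sup>2)"

text \<open>Ramanujan's \<open>f(q, q^2)\<close>, the part of \<open>\<psi>\<close> with exponents divisible by 3.\<close>

definition trisect_psi :: "complex \<Rightarrow> complex" where
  "trisect_psi q = euler_prod (q\<^sup>2) * euler_prod (q ^ 3) ^ 2 / (euler_prod q * euler_prod (q ^ 6))"

text \<open>Ramanujan's \<open>f(-q, -q^5)\<close>, which carries the part of \<open>\<phi>(-q)\<close> with exponents congruent to 1
  modulo 3.\<close>

definition trisect_phi :: "complex \<Rightarrow> complex" where
  "trisect_phi q = euler_prod q * euler_prod (q ^ 6) ^ 2 / (euler_prod (q\<^sup>2) * euler_prod (q ^ 3))"

lemma norm_power_less_one: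
  fixes q :: complex
  assumes "norm q < 1" "m > 0"
  shows "norm (q ^ m) < 1"
  using assms by (cases m) (simp_all add: norm_power power_less_one_iff del: power_Suc)

lemma euler_prod_power_nonzero: "norm q < 1 \<Longrightarrow> m > 0 \<Longrightarrow> euler_prod (q ^ m) \<noteq> 0"
  by (intro euler_prod_nonzero norm_power_less_one)

lemma q_fact_power_tendsto:
  assumes "norm q < 1" "m > 0" "k > 0"
  shows "(\<lambda>N. q_fact (q ^ m) (k * N)) \<longlonglongrightarrow> euler_prod (q ^ m)"
proof -
  have "filterlim (\<lambda>N. k * N) at_top sequentially"
    using assms(3) by (rule mult_nat_left_at_top)
  thus ?thesis
    using q_fact_tendsto[OF norm_power_less_one[OF assms(1,2)]] by (rule filterlim_compose[rotated])
qed

text \<open>The factor 2 is \<open>1 + q^0\<close>, the first member of \<open>(1 + a (ab)^k)\<close> for \<open>a = 1\<close>.\<close>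

lemma ramanujan_theta_psi:
  assumes q: "norm q < 1"
  shows "ramanujan_theta 1 q = 2 * gauss_psi q"
proof -
  define F where "F N = (\<Prod>k<N. (1 + q ^ k) * (1 + q * q ^ k) * (1 - q ^ Suc k))" for N
  have F: "F \<longlonglongrightarrow> ramanujan_theta 1 q"
    using jacobi_triple_product[of 1 q] q by (simp add: F_def [abs_def])
  \<comment> \<open>The extra factor \<open>1 + q^N\<close>, which tends to 1, lets the two products of \<open>1 + q^k\<close> end at the same
      index.\<close>
  have id: "F N * (1 + q ^ N) * q_fact q N = 2 * q_fact (q\<^sup>2) N ^ 2" for N
  proof (induction N)
    case (Suc N)
    define x where "x = q ^ N"
    have "F (Suc N) * (1 + q ^ Suc N) * q_fact q (Suc N) =
          (F N * (1 + x) * q_fact q N) * ((1 - (q * x) ^ 2) ^ 2)"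
      by (simp add: F_def q_fact_Suc x_def) algebra
    also have "\<dots> = 2 * q_fact (q\<^sup>2) (Suc N) ^ 2"
      unfolding x_def Suc by (simp add: q_fact_Suc power_mult_distrib flip: power_mult) (simp add: mult_ac)
    finally show ?case .
  qed (simp add: F_def)
  have 1: "(\<lambda>N. F N * (1 + q ^ N) * q_fact q N) \<longlonglongrightarrow> ramanujan_theta 1 q * (1 + 0) * euler_prod q"
    by (intro tendsto_intros F q_fact_tendsto q LIMSEQ_power_zero)
  have 2: "(\<lambda>N. 2 * q_fact (q\<^sup>2) N ^ 2) \<longlonglongrightarrow> 2 * euler_prod (q\<^sup>2) ^ 2"
    using q by (intro tendsto_intros q_fact_tendsto norm_power_less_one) auto
  have "ramanujan_theta 1 q * (1 + 0) * euler_prod q = 2 * euler_prod (q\<^sup>2) ^ 2"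
    using LIMSEQ_unique[OF 1] 2 by (simp add: id)
  thus ?thesis using euler_prod_nonzero[OF q] by (simp add: gauss_psi_def field_simps)
qed

lemma ramanujan_theta_phi:
  assumes q: "norm q < 1"
  shows "ramanujan_theta (- q) (- q) = gauss_phi q"
proof -
  define F where "F N = (\<Prod>k<N. (1 + - q * (- q * - q) ^ k) * (1 + - q * (- q * - q) ^ k) *
                            (1 - (- q * - q) ^ Suc k))" for N
  have F: "F \<longlonglongrightarrow> ramanujan_theta (- q) (- q)"
    using jacobi_triple_product[of "- q" "- q"] q by (simp add: F_def [abs_def])
  have id: "F N * q_fact (q ^ 2) (1 * N) = q_fact (q ^ 1) (2 * N) ^ 2" for N
  proof (induction N)
    case (Suc N)
    define x where "x = q ^ (2 * N)"
    have e: "(q * q) ^ N = x" "(q ^ 2) ^ N = x" by (simp_all add: x_def power_mult power2_eq_square)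
    have i: "2 * Suc N = Suc (Suc (2 * N))" "1 * Suc N = Suc N" "1 * N = N" by simp_all
    have s1: "F (Suc N) = F N * ((1 - q * x)\<^sup>2 * (1 - q ^ 2 * x))"
      by (simp add: F_def e power2_eq_square mult_ac)
    have s2: "q_fact (q ^ 2) (1 * Suc N) = q_fact (q ^ 2) (1 * N) * (1 - q ^ 2 * x)"
      unfolding i q_fact_Suc power_Suc e ..
    have s3: "q_fact (q ^ 1) (2 * Suc N) = q_fact (q ^ 1) (2 * N) * ((1 - q * x) * (1 - q ^ 2 * x))"
      unfolding i q_fact_Suc power_Suc power_one_right x_def[symmetric] by algebra
    have "F (Suc N) * q_fact (q ^ 2) (1 * Suc N) =
          (F N * q_fact (q ^ 2) (1 * N)) * ((1 - q * x) * (1 - q ^ 2 * x))\<^sup>2"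
      unfolding s1 s2 by algebra
    also have "\<dots> = q_fact (q ^ 1) (2 * Suc N) ^ 2"
      unfolding Suc s3 by (simp add: power_mult_distrib)
    finally show ?case .
  qed (simp add: F_def)
  have 1: "(\<lambda>N. F N * q_fact (q ^ 2) (1 * N)) \<longlonglongrightarrow> ramanujan_theta (- q) (- q) * euler_prod (q ^ 2)"
    by (intro tendsto_intros F q_fact_power_tendsto q) auto
  have 2: "(\<lambda>N. q_fact (q ^ 1) (2 * N) ^ 2) \<longlonglongrightarrow> euler_prod (q ^ 1) ^ 2"
    by (intro tendsto_intros q_fact_power_tendsto q) auto
  have "ramanujan_theta (- q) (- q) * euler_prod (q ^ 2) = euler_prod q ^ 2"
    using LIMSEQ_unique[OF 1[unfolded id] 2] by simp
  thus ?thesis using euler_prod_power_nonzero[OF q, of 2] by (simp add: gauss_phi_def field_simps)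
qed

text \<open>In this proof and the next a block of factors is sorted by residue modulo 3 or 6; the variable
  \<open>x\<close> stands for the common power of \<open>q\<close> at the start of the block.\<close>

lemma ramanujan_theta_trisect_psi:
  assumes q: "norm q < 1"
  shows "ramanujan_theta q (q ^ 2) = trisect_psi q"
proof -
  define F where "F N = (\<Prod>k<N. (1 + q * (q * q ^ 2) ^ k) * (1 + q ^ 2 * (q * q ^ 2) ^ k) *
                            (1 - (q * q ^ 2) ^ Suc k))" for N
  have F: "F \<longlonglongrightarrow> ramanujan_theta q (q ^ 2)"
    using jacobi_triple_product[of q "q ^ 2"] q norm_power_less_one[OF q, of 2]
    by (simp add: F_def [abs_def])
  have id: "F N * q_fact (q ^ 1) (3 * N) * q_fact (q ^ 6) (1 * N) =
            q_fact (q ^ 2) (3 * N) * q_fact (q ^ 3) (1 * N) ^ 2" for N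
  proof (induction N)
    case (Suc N)
    define x where "x = q ^ (3 * N)"
    have e: "(q * q ^ 2) ^ N = x" "(q ^ 3) ^ N = x" "(q ^ 6) ^ N = x\<^sup>2" "(q ^ 2) ^ (3 * N) = x\<^sup>2"
            "q ^ (3 * N) = x"
      by (simp_all add: x_def flip: power_mult power_Suc)
    define a b c where "a = (1 - (q*x)\<^sup>2)" and "b = (1 - (q^2*x)\<^sup>2)" and "c = (1 - (q^3*x)\<^sup>2)"
    have i: "3 * Suc N = Suc (Suc (Suc (3 * N)))" "1 * Suc N = Suc N" "1 * N = N" by simp_all
    have s1: "F (Suc N) = F N * ((1 + q * x) * (1 + q ^ 2 * x) * (1 - q ^ 3 * x))"
      unfolding F_def prod.lessThan_Suc power_Suc e by algebra
    have s2: "q_fact (q ^ 1) (3 * Suc N) = q_fact (q ^ 1) (3 * N) * ((1 - q * x) * (1 - q ^ 2 * x) * (1 - q ^ 3 * x))"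
      unfolding i q_fact_Suc power_Suc power_one_right e by algebra
    have s3: "q_fact (q ^ 6) (1 * Suc N) = q_fact (q ^ 6) (1 * N) * c"
      unfolding i q_fact_Suc power_Suc e c_def by algebra
    have s4: "q_fact (q ^ 2) (3 * Suc N) = q_fact (q ^ 2) (3 * N) * (a * b * c)"
      unfolding i q_fact_Suc power_Suc e a_def b_def c_def by algebra
    have s5: "q_fact (q ^ 3) (1 * Suc N) = q_fact (q ^ 3) (1 * N) * (1 - q ^ 3 * x)"
      unfolding i q_fact_Suc by (simp add: e)
    have "F (Suc N) * q_fact (q ^ 1) (3 * Suc N) * q_fact (q ^ 6) (1 * Suc N) =
          (F N * q_fact (q ^ 1) (3 * N) * q_fact (q ^ 6) (1 * N)) * (a * b * c * (1 - q ^ 3 * x)\<^sup>2)"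
      unfolding s1 s2 s3 a_def b_def by algebra
    also have "\<dots> = q_fact (q ^ 2) (3 * Suc N) * q_fact (q ^ 3) (1 * Suc N) ^ 2"
      unfolding Suc s4 s5 by (simp add: mult_ac power_mult_distrib)
    finally show ?case .
  qed (simp add: F_def)
  have 1: "(\<lambda>N. F N * q_fact (q ^ 1) (3 * N) * q_fact (q ^ 6) (1 * N)) \<longlonglongrightarrow>
      ramanujan_theta q (q ^ 2) * euler_prod (q ^ 1) * euler_prod (q ^ 6)"
    by (intro tendsto_intros F q_fact_power_tendsto q) auto
  have 2: "(\<lambda>N. q_fact (q ^ 2) (3 * N) * q_fact (q ^ 3) (1 * N) ^ 2) \<longlonglongrightarrow>
      euler_prod (q ^ 2) * euler_prod (q ^ 3) ^ 2"
    by (intro tendsto_intros q_fact_power_tendsto q) auto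
  have "ramanujan_theta q (q ^ 2) * euler_prod q * euler_prod (q ^ 6) =
      euler_prod (q ^ 2) * euler_prod (q ^ 3) ^ 2"
    using LIMSEQ_unique[OF 1[unfolded id] 2] by simp
  thus ?thesis using euler_prod_power_nonzero[OF q, of 6] euler_prod_nonzero[OF q]
    by (simp add: trisect_psi_def field_simps)
qed

lemma ramanujan_theta_trisect_phi:
  assumes q: "norm q < 1"
  shows "ramanujan_theta (- q) (- (q ^ 5)) = trisect_phi q"
proof -
  define F where "F N = (\<Prod>k<N. (1 + - q * (- q * - (q ^ 5)) ^ k) * (1 + - (q ^ 5) * (- q * - (q ^ 5)) ^ k) *
                            (1 - (- q * - (q ^ 5)) ^ Suc k))" for N
  have F: "F \<longlonglongrightarrow> ramanujan_theta (- q) (- (q ^ 5))"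
    using jacobi_triple_product[of "- q" "- (q ^ 5)"] q norm_power_less_one[OF q, of 5]
    by (simp add: F_def [abs_def])
  have id: "F N * q_fact (q ^ 2) (3 * N) * q_fact (q ^ 3) (2 * N) =
            q_fact (q ^ 1) (6 * N) * q_fact (q ^ 6) (1 * N) ^ 2" for N
  proof (induction N)
    case (Suc N)
    define x where "x = q ^ (6 * N)"
    have e: "(- q * - (q ^ 5)) ^ N = x" "(q ^ 6) ^ N = x" "(q ^ 3) ^ (2 * N) = x" "(q ^ 2) ^ (3 * N) = x"
            "q ^ (6 * N) = x"
      by (simp_all add: x_def flip: power_mult power_Suc)
    have i: "3 * Suc N = Suc (Suc (Suc (3 * N)))" "2 * Suc N = Suc (Suc (2 * N))"
       "6 * Suc N = Suc (Suc (Suc (Suc (Suc (Suc (6 * N))))))"  "1 * Suc N = Suc N" "1 * N = N" by simp_all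
    have s1: "F (Suc N) = F N * ((1 - q * x) * (1 - q ^ 5 * x) * (1 - q ^ 6 * x))"
      unfolding F_def prod.lessThan_Suc power_Suc e by algebra
    have s2: "q_fact (q ^ 1) (6 * Suc N) = q_fact (q ^ 1) (6 * N) * ((1 - q * x) * (1 - q ^ 2 * x) *
        (1 - q ^ 3 * x) * (1 - q ^ 4 * x) * (1 - q ^ 5 * x) * (1 - q ^ 6 * x))"
      unfolding i q_fact_Suc power_Suc power_one_right e by algebra
    have s3: "q_fact (q ^ 6) (1 * Suc N) = q_fact (q ^ 6) (1 * N) * (1 - q ^ 6 * x)"
      unfolding i q_fact_Suc by (simp add: e)
    have s4: "q_fact (q ^ 2) (3 * Suc N) = q_fact (q ^ 2) (3 * N) *
        ((1 - q ^ 2 * x) * (1 - q ^ 4 * x) * (1 - q ^ 6 * x))"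
      unfolding i q_fact_Suc power_Suc e by algebra
    have s5: "q_fact (q ^ 3) (2 * Suc N) = q_fact (q ^ 3) (2 * N) * ((1 - q ^ 3 * x) * (1 - q ^ 6 * x))"
      unfolding i q_fact_Suc power_Suc e by algebra
    have "F (Suc N) * q_fact (q ^ 2) (3 * Suc N) * q_fact (q ^ 3) (2 * Suc N) =
          (F N * q_fact (q ^ 2) (3 * N) * q_fact (q ^ 3) (2 * N)) * 
          ((1 - q * x) * (1 - q ^ 2 * x) * (1 - q ^ 3 * x) * (1 - q ^ 4 * x) * (1 - q ^ 5 * x) *
            (1 - q ^ 6 * x) ^ 3)"
      unfolding s1 s4 s5 power3_eq_cube[of "1 - q ^ 6 * x"] by (simp only: mult_ac)
    also have "\<dots> = q_fact (q ^ 1) (6 * Suc N) * q_fact (q ^ 6) (1 * Suc N) ^ 2"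
      unfolding Suc s2 s3 power3_eq_cube[of "1 - q ^ 6 * x"] power_mult_distrib
        power2_eq_square[of "1 - q ^ 6 * x"] by (simp only: mult_ac)
    finally show ?case .
  qed (simp add: F_def)
  have 1: "(\<lambda>N. F N * q_fact (q ^ 2) (3 * N) * q_fact (q ^ 3) (2 * N)) \<longlonglongrightarrow>
      ramanujan_theta (- q) (- (q ^ 5)) * euler_prod (q ^ 2) * euler_prod (q ^ 3)"
    by (intro tendsto_intros F q_fact_power_tendsto q) auto
  have 2: "(\<lambda>N. q_fact (q ^ 1) (6 * N) * q_fact (q ^ 6) (1 * N) ^ 2) \<longlonglongrightarrow>
      euler_prod (q ^ 1) * euler_prod (q ^ 6) ^ 2"
    by (intro tendsto_intros q_fact_power_tendsto q) auto
  have "ramanujan_theta (- q) (- (q ^ 5)) * euler_prod (q ^ 2) * euler_prod (q ^ 3) =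
      euler_prod q * euler_prod (q ^ 6) ^ 2"
    using LIMSEQ_unique[OF 1[unfolded id] 2] by simp
  thus ?thesis using euler_prod_power_nonzero[OF q, of 2] euler_prod_power_nonzero[OF q, of 3]
    by (simp add: trisect_phi_def field_simps)
qed

section \<open>Trisection of the theta series\<close>

lemma triangle_times_two:
  "2 * int (nat (n * (n + 1) div 2)) = n * (n + 1)" "2 * int (nat (n * (n - 1) div 2)) = n * (n - 1)"
proof -
  have "even (n * (n + 1))" "even (n * (n - 1))" by auto
  thus "2 * int (nat (n * (n + 1) div 2)) = n * (n + 1)" "2 * int (nat (n * (n - 1) div 2)) = n * (n - 1)"
    using int_triangle_nonneg[of n] by auto
qed

text \<open>Reduces an identity between terms of two theta series in powers of the same \<open>x\<close> to a polynomial
  identity between (doubled) exponents over the integers.\<close>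

lemma theta_term_powers_eq:
  assumes "int i * (m * (m + 1)) + int j * (m * (m - 1)) =
           2 * int r + int k * (n * (n + 1)) + int l * (n * (n - 1))"
  shows "theta_term (x ^ i) (x ^ j) m = x ^ r * theta_term (x ^ k) (x ^ l) n"
proof -
  define u v s t where "u = nat (m * (m + 1) div 2)" and "v = nat (m * (m - 1) div 2)"
    and "s = nat (n * (n + 1) div 2)" and "t = nat (n * (n - 1) div 2)"
  have "int i * (2 * int u) + int j * (2 * int v) = 2 * int r + int k * (2 * int s) + int l * (2 * int t)"
    unfolding u_def v_def s_def t_def triangle_times_two using assms .
  hence "2 * int (i * u + j * v) = 2 * int (r + (k * s + l * t))"
    by (simp add: algebra_simps)
  hence "i * u + j * v = r + (k * s + l * t)"
    by (metis mult_cancel_left of_nat_eq_iff zero_neq_numeral)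
  hence "x ^ (i * u + j * v) = x ^ (r + (k * s + l * t))" by simp
  thus ?thesis
    unfolding theta_term_def u_def[symmetric] v_def[symmetric] s_def[symmetric] t_def[symmetric]
    by (simp add: power_add power_mult)
qed

lemma infsum_int_mod_3:
  fixes f :: "int \<Rightarrow> complex"
  assumes "f summable_on UNIV"
  shows "(\<Sum>\<^sub>\<infinity>n. f n) = (\<Sum>\<^sub>\<infinity>m. f (3 * m)) + (\<Sum>\<^sub>\<infinity>m. f (3 * m + 1)) + (\<Sum>\<^sub>\<infinity>m. f (3 * m - 1))"
proof -
  let ?A = "range (\<lambda>m::int. 3 * m)" and ?B = "range (\<lambda>m::int. 3 * m + 1)" and ?C = "range (\<lambda>m::int. 3 * m - 1)"
  have U: "UNIV = ?A \<union> ?B \<union> ?C"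
  proof (intro set_eqI iffI UNIV_I)
    fix n :: int
    have "n = 3 * (n div 3) \<or> n = 3 * (n div 3) + 1 \<or> n = 3 * (n div 3 + 1) - 1" by presburger
    thus "n \<in> ?A \<union> ?B \<union> ?C" by blast
  qed
  have disj: "?A \<inter> ?B = {}" "(?A \<union> ?B) \<inter> ?C = {}" by (auto, presburger+)
  have s: "f summable_on S" for S using summable_on_subset[OF assms] by simp
  have "(\<Sum>\<^sub>\<infinity>n. f n) = infsum f ?A + infsum f ?B + infsum f ?C"
    by (subst U, subst infsum_Un_disjoint[OF s s disj(2)], subst infsum_Un_disjoint[OF s s disj(1)]) simp
  thus ?thesis by (simp add: infsum_reindex inj_def o_def)
qed

lemma infsum_int_uminus: "(\<Sum>\<^sub>\<infinity>m::int. f (- m)) = (\<Sum>\<^sub>\<infinity>m. (f m :: complex))"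
  by (rule infsum_reindex_bij_witness[of _ uminus uminus]) auto

text \<open>In the series \<open>2 \<psi>(q) = \<Sum>n. q^(n(n-1)/2)\<close> over all integers the classes \<open>n = 3m\<close> and \<open>n = 3m + 1\<close>
  are mirror images of each other and both give \<open>f(q^3, q^6)\<close>; the class \<open>n = 3m - 1\<close> reproduces
  \<open>\<psi>\<close> at \<open>q^9\<close>.\<close>

lemma psi_trisection:
  assumes q: "norm q < 1"
  shows "gauss_psi q = trisect_psi (q ^ 3) + q * gauss_psi (q ^ 9)"
proof -
  have t: "theta_term 1 q (3 * m) = theta_term (q ^ 3) ((q ^ 3) ^ 2) m"
          "theta_term 1 q (3 * m + 1) = theta_term (q ^ 3) ((q ^ 3) ^ 2) (- m)"
          "theta_term 1 q (3 * m - 1) = q * theta_term 1 (q ^ 9) m" for m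
    using theta_term_powers_eq[of 0 "3 * m" 1 0 3 m 6 q] theta_term_powers_eq[of 0 "3 * m + 1" 1 0 3 "- m" 6 q]
      theta_term_powers_eq[of 0 "3 * m - 1" 1 1 0 m 9 q]
    by (simp_all add: algebra_simps flip: power_mult)
  have "ramanujan_theta 1 q = ramanujan_theta (q ^ 3) ((q ^ 3) ^ 2) + ramanujan_theta (q ^ 3) ((q ^ 3) ^ 2)
      + q * ramanujan_theta 1 (q ^ 9)"
    unfolding ramanujan_theta_def
    by (subst infsum_int_mod_3) (use q in \<open>simp_all add: theta_term_summable t infsum_cmult_right' infsum_int_uminus\<close>)
  hence "2 * gauss_psi q = 2 * (trisect_psi (q ^ 3) + q * gauss_psi (q ^ 9))"
    using q ramanujan_theta_psi[OF q] ramanujan_theta_psi[of "q ^ 9"] ramanujan_theta_trisect_psi[of "q ^ 3"] norm_power_less_one[OF q, of 9]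
      norm_power_less_one[OF q, of 3]
    by (simp add: algebra_simps)
  thus ?thesis by (metis mult_cancel_left zero_neq_numeral)
qed

text \<open>Here the exponents are squares: the class \<open>n = 3m\<close> reproduces \<open>\<phi>\<close>, and the classes \<open>3m + 1\<close> and
  \<open>3m - 1\<close> coincide up to \<open>m \<mapsto> -m\<close>.\<close>

lemma phi_trisection:
  assumes q: "norm q < 1"
  shows "gauss_phi q = gauss_phi (q ^ 9) - 2 * q * trisect_phi (q ^ 3)"
proof -
  define x where "x = - q"
  have x: "norm x < 1" "norm (x ^ 15) < 1" "norm (x ^ 3) \<le> 1"
    using q norm_power_less_one[of x 15] norm_power_less_one[of x 3] by (auto simp: x_def)
  have t: "theta_term x x (3 * m) = theta_term (x ^ 9) (x ^ 9) m"
          "theta_term x x (3 * m + 1) = x * theta_term (x ^ 3) (x ^ 15) (- m)"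
          "theta_term x x (3 * m - 1) = x * theta_term (x ^ 3) (x ^ 15) m" for m
    using theta_term_powers_eq[of 1 "3 * m" 1 0 9 m 9 x] theta_term_powers_eq[of 1 "3 * m + 1" 1 1 3 "- m" 15 x]
      theta_term_powers_eq[of 1 "3 * m - 1" 1 1 3 m 15 x]
    by (simp_all add: algebra_simps)
  have "ramanujan_theta x x = ramanujan_theta (x ^ 9) (x ^ 9) + x * ramanujan_theta (x ^ 3) (x ^ 15)
      + x * ramanujan_theta (x ^ 3) (x ^ 15)"
    unfolding ramanujan_theta_def
    by (subst infsum_int_mod_3)
       (use x in \<open>simp_all add: theta_term_summable t infsum_cmult_right'
          infsum_int_uminus[of "\<lambda>m. theta_term (x ^ 3) (x ^ 15) m"]\<close>)
  moreover have "x ^ 9 = - (q ^ 9)" "x ^ 3 = - (q ^ 3)" "x ^ 15 = - ((q ^ 3) ^ 5)"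
    by (simp_all add: x_def flip: power_mult)
  ultimately show ?thesis
    using ramanujan_theta_phi[OF q] ramanujan_theta_phi[of "q ^ 9"] ramanujan_theta_trisect_phi[of "q ^ 3"] norm_power_less_one[OF q, of 9] norm_power_less_one[OF q, of 3]
    by (simp add: x_def)
qed

section \<open>Products over cube roots of unity\<close>

text \<open>For a primitive cube root of unity \<open>w\<close>, the three conjugates of \<open>1 - q^n\<close> multiply to \<open>1 - q^(3n)\<close>
  if 3 does not divide \<open>n\<close>, and to \<open>(1 - q^n)^3\<close> otherwise.\<close>

lemma q_fact_cube_roots:
  fixes w :: complex
  assumes w: "w\<^sup>2 + w + 1 = 0"
  shows "q_fact q (3 * N) * q_fact (w * q) (3 * N) * q_fact (w\<^sup>2 * q) (3 * N) * q_fact (q ^ 9) (1 * N)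
         = q_fact (q ^ 3) (3 * N) * q_fact (q ^ 3) (1 * N) ^ 3"
proof (induction N)
  case (Suc N)
  define x where "x = q ^ (3 * N)"
  have w3: "w ^ 3 = 1" using w by algebra
  have e: "q ^ (3 * N) = x" "(w * q) ^ (3 * N) = x" "(w\<^sup>2 * q) ^ (3 * N) = x" "(q ^ 3) ^ N = x"
          "(q ^ 9) ^ N = x ^ 3" "(q ^ 3) ^ (3 * N) = x ^ 3"
    using w3 by (simp_all add: x_def power_mult_distrib power_mult power2_eq_square)
       (simp_all flip: power_mult add: mult.commute)
  have i: "3 * Suc N = Suc (Suc (Suc (3 * N)))" "1 * Suc N = Suc N" "1 * N = N" by simp_all
  define f g where "f = q_fact (q ^ 3) (3 * N)" and "g = q_fact (q ^ 3) N"
  define y where "y = 1 - q ^ 3 * x"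
  have s1: "q_fact q (3 * Suc N) = q_fact q (3 * N) * ((1 - q * x) * (1 - q\<^sup>2 * x) * y)"
    unfolding i q_fact_Suc power_Suc e y_def by algebra
  have s2: "q_fact (w * q) (3 * Suc N) = q_fact (w * q) (3 * N) * ((1 - w * q * x) * (1 - w\<^sup>2 * q\<^sup>2 * x) * y)"
    unfolding i q_fact_Suc power_Suc e y_def using w3 by algebra
  have s3: "q_fact (w\<^sup>2 * q) (3 * Suc N) = q_fact (w\<^sup>2 * q) (3 * N) * ((1 - w\<^sup>2 * q * x) * (1 - w * q\<^sup>2 * x) * y)"
    unfolding i q_fact_Suc power_Suc e y_def using w3 by algebra
  have s4: "q_fact (q ^ 9) (1 * Suc N) = q_fact (q ^ 9) (1 * N) * (1 - q ^ 9 * x ^ 3)"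
    unfolding i q_fact_Suc power_Suc e by (rule refl)
  have s5: "q_fact (q ^ 3) (3 * Suc N) = q_fact (q ^ 3) (3 * N) *
      ((1 - q ^ 3 * x ^ 3) * (1 - q ^ 6 * x ^ 3) * (1 - q ^ 9 * x ^ 3))"
    unfolding i q_fact_Suc power_Suc e by algebra
  have s6: "q_fact (q ^ 3) (1 * Suc N) = q_fact (q ^ 3) (1 * N) * y"
    unfolding i q_fact_Suc power_Suc e y_def by (rule refl)
  have r1: "(1 - q * x) * (1 - w * q * x) * (1 - w\<^sup>2 * q * x) = 1 - q ^ 3 * x ^ 3"
    using w by algebra
  have r2: "(1 - q\<^sup>2 * x) * (1 - w\<^sup>2 * q\<^sup>2 * x) * (1 - w * q\<^sup>2 * x) = 1 - q ^ 6 * x ^ 3"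
    using w by algebra
  have "q_fact q (3 * Suc N) * q_fact (w * q) (3 * Suc N) * q_fact (w\<^sup>2 * q) (3 * Suc N) * q_fact (q ^ 9) (1 * Suc N)
    = (q_fact q (3 * N) * q_fact (w * q) (3 * N) * q_fact (w\<^sup>2 * q) (3 * N) * q_fact (q ^ 9) (1 * N)) *
      (((1 - q * x) * (1 - w * q * x) * (1 - w\<^sup>2 * q * x)) *
       ((1 - q\<^sup>2 * x) * (1 - w\<^sup>2 * q\<^sup>2 * x) * (1 - w * q\<^sup>2 * x)) * (1 - q ^ 9 * x ^ 3) * (y * y * y))"
    unfolding s1 s2 s3 s4 by (simp only: mult_ac)
  also have "\<dots> = q_fact (q ^ 3) (3 * Suc N) * q_fact (q ^ 3) (1 * Suc N) ^ 3"
    unfolding Suc r1 r2 s5 s6 power_mult_distrib power3_eq_cube[of y] by (simp only: mult_ac)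
  finally show ?case .
qed simp

lemma cube_root_of_unity_norm:
  fixes w :: complex
  assumes "w\<^sup>2 + w + 1 = 0"
  shows "norm w = 1"
proof -
  have "w ^ 3 = 1" using assms by algebra
  hence "norm w ^ 3 = 1 ^ 3" by (metis norm_one norm_power power_one)
  thus ?thesis by (rule power_eq_imp_eq_base) auto
qed

lemma euler_prod_cube_roots:
  assumes q: "norm q < 1" and w: "w\<^sup>2 + w + 1 = 0"
  shows "euler_prod q * euler_prod (w * q) * euler_prod (w\<^sup>2 * q) = euler_prod (q ^ 3) ^ 4 / euler_prod (q ^ 9)"
proof -
  note nw = cube_root_of_unity_norm[OF w]
  have n: "norm (w * q) < 1" "norm (w\<^sup>2 * q) < 1" using q by (simp_all add: norm_mult norm_power nw)
  have 1: "(\<lambda>N. q_fact (q ^ 1) (3 * N) * q_fact ((w * q) ^ 1) (3 * N) * q_fact ((w\<^sup>2 * q) ^ 1) (3 * N) * q_fact (q ^ 9) (1 * N))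
     \<longlonglongrightarrow> euler_prod (q ^ 1) * euler_prod ((w * q) ^ 1) * euler_prod ((w\<^sup>2 * q) ^ 1) * euler_prod (q ^ 9)"
    by (intro tendsto_intros q_fact_power_tendsto q n) auto
  have 2: "(\<lambda>N. q_fact (q ^ 3) (3 * N) * q_fact (q ^ 3) (1 * N) ^ 3) \<longlonglongrightarrow> euler_prod (q ^ 3) * euler_prod (q ^ 3) ^ 3"
    by (intro tendsto_intros q_fact_power_tendsto q) auto
  have "euler_prod q * euler_prod (w * q) * euler_prod (w\<^sup>2 * q) * euler_prod (q ^ 9) =
        euler_prod (q ^ 3) * euler_prod (q ^ 3) ^ 3"
    using LIMSEQ_unique[OF 1[unfolded power_one_right q_fact_cube_roots[OF w]] 2] .
  thus ?thesis using euler_prod_power_nonzero[OF q, of 9]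
    by (simp add: field_simps eval_nat_numeral)
qed

lemma cube_root_of_unity: "\<exists>w::complex. w\<^sup>2 + w + 1 = 0"
proof
  show "(Complex (-1/2) (sqrt 3 / 2))\<^sup>2 + Complex (-1/2) (sqrt 3 / 2) + 1 = 0"
    by (simp add: complex_eq_iff power2_eq_square field_simps)
qed

lemma cube_root_exists:
  fixes q :: complex
  assumes "norm q < 1"
  obtains r where "r ^ 3 = q" "norm r < 1"
proof -
  obtain r where r: "r ^ 3 = q" using exists_complex_root[of 3 q] by auto
  have "norm r < 1"
  proof (rule ccontr)
    assume "\<not> norm r < 1"
    hence "1 \<le> norm r ^ 3" by (intro one_le_power) auto
    thus False using assms by (simp add: r[symmetric] norm_power)
  qed
  thus ?thesis using that r by blast
qed

text \<open>Squaring maps \<open>w\<close> to the other primitive cube root of unity, so this is the preceding product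
  formula at \<open>q^2\<close>.\<close>

lemma euler_prod_sq_cube_roots:
  assumes q: "norm q < 1" and w: "w\<^sup>2 + w + 1 = 0"
  shows "euler_prod (q\<^sup>2) * euler_prod ((w * q)\<^sup>2) * euler_prod ((w\<^sup>2 * q)\<^sup>2) =
         euler_prod (q ^ 6) ^ 4 / euler_prod (q ^ 18)"
proof -
  have "w ^ 3 = 1" using w by algebra
  hence w4: "(w\<^sup>2)\<^sup>2 = w" by algebra
  have w2: "(w\<^sup>2)\<^sup>2 + w\<^sup>2 + 1 = 0" using w by algebra
  have "euler_prod (q\<^sup>2) * euler_prod (w\<^sup>2 * q\<^sup>2) * euler_prod ((w\<^sup>2)\<^sup>2 * q\<^sup>2) =
         euler_prod ((q\<^sup>2) ^ 3) ^ 4 / euler_prod ((q\<^sup>2) ^ 9)"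
    by (rule euler_prod_cube_roots[OF norm_power_less_one[OF q] w2]) auto
  thus ?thesis by (simp add: power_mult_distrib w4 flip: power_mult)
qed

lemma eta_quotients_nonzero:
  assumes "norm q < 1"
  shows "gauss_psi q \<noteq> 0" "gauss_phi q \<noteq> 0" "trisect_psi q \<noteq> 0" "trisect_phi q \<noteq> 0"
  using euler_prod_nonzero[OF assms] euler_prod_power_nonzero[OF assms, of 2]
    euler_prod_power_nonzero[OF assms, of 3] euler_prod_power_nonzero[OF assms, of 6]
  by (auto simp: gauss_psi_def gauss_phi_def trisect_psi_def trisect_phi_def)

text \<open>Take a cube root \<open>r\<close> of \<open>q\<close>.  The product of \<open>\<psi>\<close> over the three cube roots of \<open>q\<close> is
  \<open>\<psi>(q)^4 / \<psi>(q^3)\<close> by the Euler products, and \<open>a^3 + q b^3\<close> by the trisection \<open>a + r b\<close>, with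
  \<open>a = f(q, q^2)\<close> and \<open>b = \<psi>(q^3)\<close>.\<close>

lemma psi_fourth_power:
  assumes q: "norm q < 1"
  shows "gauss_psi q ^ 4 - q * gauss_psi (q ^ 3) ^ 4 = trisect_psi q ^ 3 * gauss_psi (q ^ 3)"
proof -
  obtain r where r: "r ^ 3 = q" "norm r < 1" using cube_root_exists[OF q] .
  obtain w :: complex where w: "w\<^sup>2 + w + 1 = 0" using cube_root_of_unity by blast
  have w3: "w ^ 3 = 1" using w by algebra
  note nw = cube_root_of_unity_norm[OF w]
  have n: "norm (w * r) < 1" "norm (w\<^sup>2 * r) < 1" using r by (simp_all add: norm_mult norm_power nw)
  have p: "(w * r) ^ 3 = q" "(w\<^sup>2 * r) ^ 3 = q" "(w * r) ^ 9 = q ^ 3" "(w\<^sup>2 * r) ^ 9 = q ^ 3" "r ^ 9 = q ^ 3"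
    using w3 r(1) by algebra+
  define a b where "a = trisect_psi q" and "b = gauss_psi (q ^ 3)"
  have "gauss_psi r * gauss_psi (w * r) * gauss_psi (w\<^sup>2 * r) =
        (a + r * b) * (a + w * r * b) * (a + w\<^sup>2 * r * b)"
    using psi_trisection[OF r(2)] psi_trisection[OF n(1)] psi_trisection[OF n(2)] p r(1)
    by (simp add: a_def b_def)
  also have "\<dots> = a ^ 3 + q * b ^ 3" using w r(1) by algebra
  finally have 1: "gauss_psi r * gauss_psi (w * r) * gauss_psi (w\<^sup>2 * r) = a ^ 3 + q * b ^ 3" .
  have "gauss_psi r * gauss_psi (w * r) * gauss_psi (w\<^sup>2 * r) =
     (euler_prod (r\<^sup>2) * euler_prod ((w * r)\<^sup>2) * euler_prod ((w\<^sup>2 * r)\<^sup>2))\<^sup>2 /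
     (euler_prod r * euler_prod (w * r) * euler_prod (w\<^sup>2 * r))"
    by (simp add: gauss_psi_def power_mult_distrib)
  also have "\<dots> = (euler_prod (r ^ 6) ^ 4 / euler_prod (r ^ 18))\<^sup>2 / (euler_prod (r ^ 3) ^ 4 / euler_prod (r ^ 9))"
    by (simp only: euler_prod_sq_cube_roots[OF r(2) w] euler_prod_cube_roots[OF r(2) w])
  also have "r ^ 6 = q\<^sup>2" by (simp flip: r(1) power_mult)
  also have "r ^ 18 = (q ^ 3)\<^sup>2" by (simp flip: r(1) power_mult)
  also have "r ^ 9 = q ^ 3" by (simp flip: r(1) power_mult)
  also have "(euler_prod (q\<^sup>2) ^ 4 / euler_prod ((q ^ 3)\<^sup>2))\<^sup>2 / (euler_prod (r ^ 3) ^ 4 / euler_prod (q ^ 3))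
     = gauss_psi q ^ 4 / b"
    by (simp add: r(1) gauss_psi_def b_def power_divide flip: power_mult)
  finally have "gauss_psi q ^ 4 / b = a ^ 3 + q * b ^ 3" using 1 by simp
  moreover have "b \<noteq> 0" unfolding b_def by (intro eta_quotients_nonzero norm_power_less_one q) auto
  ultimately have "gauss_psi q ^ 4 = (a ^ 3 + q * b ^ 3) * b" by (simp add: field_simps)
  thus ?thesis unfolding a_def b_def by algebra
qed

text \<open>The same argument as for \<open>\<psi>\<close>, from the trisection of \<open>\<phi>(-q)\<close>; the 8 is the cube of its factor 2.\<close>

lemma phi_fourth_power:
  assumes q: "norm q < 1"
  shows "gauss_phi (q ^ 3) ^ 4 - gauss_phi q ^ 4 = 8 * q * gauss_phi (q ^ 3) * trisect_phi q ^ 3"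
proof -
  obtain r where r: "r ^ 3 = q" "norm r < 1" using cube_root_exists[OF q] .
  obtain w :: complex where w: "w\<^sup>2 + w + 1 = 0" using cube_root_of_unity by blast
  have w3: "w ^ 3 = 1" using w by algebra
  note nw = cube_root_of_unity_norm[OF w]
  have n: "norm (w * r) < 1" "norm (w\<^sup>2 * r) < 1" using r by (simp_all add: norm_mult norm_power nw)
  have p: "(w * r) ^ 3 = q" "(w\<^sup>2 * r) ^ 3 = q" "(w * r) ^ 9 = q ^ 3" "(w\<^sup>2 * r) ^ 9 = q ^ 3" "r ^ 9 = q ^ 3"
    using w3 r(1) by algebra+
  define a b where "a = gauss_phi (q ^ 3)" and "b = trisect_phi q"
  have "gauss_phi r * gauss_phi (w * r) * gauss_phi (w\<^sup>2 * r) =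
        (a - 2 * r * b) * (a - 2 * (w * r) * b) * (a - 2 * (w\<^sup>2 * r) * b)"
    using phi_trisection[OF r(2)] phi_trisection[OF n(1)] phi_trisection[OF n(2)] p r(1)
    by (simp add: a_def b_def)
  also have "\<dots> = a ^ 3 - 8 * q * b ^ 3" using w r(1) by algebra
  finally have 1: "gauss_phi r * gauss_phi (w * r) * gauss_phi (w\<^sup>2 * r) = a ^ 3 - 8 * q * b ^ 3" .
  have "gauss_phi r * gauss_phi (w * r) * gauss_phi (w\<^sup>2 * r) =
     (euler_prod r * euler_prod (w * r) * euler_prod (w\<^sup>2 * r))\<^sup>2 /
     (euler_prod (r\<^sup>2) * euler_prod ((w * r)\<^sup>2) * euler_prod ((w\<^sup>2 * r)\<^sup>2))"
    by (simp add: gauss_phi_def power_mult_distrib)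
  also have "\<dots> = (euler_prod (r ^ 3) ^ 4 / euler_prod (r ^ 9))\<^sup>2 / (euler_prod (r ^ 6) ^ 4 / euler_prod (r ^ 18))"
    by (simp only: euler_prod_sq_cube_roots[OF r(2) w] euler_prod_cube_roots[OF r(2) w])
  also have "r ^ 6 = q\<^sup>2" by (simp flip: r(1) power_mult)
  also have "r ^ 18 = (q ^ 3)\<^sup>2" by (simp flip: r(1) power_mult)
  also have "r ^ 9 = q ^ 3" by (simp flip: r(1) power_mult)
  also have "(euler_prod (r ^ 3) ^ 4 / euler_prod (q ^ 3))\<^sup>2 / (euler_prod (q\<^sup>2) ^ 4 / euler_prod ((q ^ 3)\<^sup>2))
     = gauss_phi q ^ 4 / a"
    by (simp add: r(1) gauss_phi_def a_def power_divide flip: power_mult)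
  finally have "gauss_phi q ^ 4 / a = a ^ 3 - 8 * q * b ^ 3" using 1 by simp
  moreover have "a \<noteq> 0" unfolding a_def by (intro eta_quotients_nonzero norm_power_less_one q) auto
  ultimately have "gauss_phi q ^ 4 = (a ^ 3 - 8 * q * b ^ 3) * a" by (simp add: field_simps)
  thus ?thesis unfolding a_def b_def by algebra
qed

lemma eta_quotient_relations:
  assumes q: "norm q < 1"
  shows "trisect_psi q * trisect_phi q = gauss_psi (q ^ 3) * gauss_phi (q ^ 3)"
    and "trisect_psi q ^ 3 * gauss_phi q = gauss_phi (q ^ 3) ^ 3 * gauss_psi q"
proof -
  define a b c d where "a = euler_prod q" and "b = euler_prod (q\<^sup>2)" and "c = euler_prod (q ^ 3)"
    and "d = euler_prod (q ^ 6)"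
  have nz: "a \<noteq> 0" "b \<noteq> 0" "c \<noteq> 0" "d \<noteq> 0"
    using euler_prod_nonzero[OF q] euler_prod_power_nonzero[OF q]
    by (auto simp: a_def b_def c_def d_def)
  have e: "trisect_psi q = b * c\<^sup>2 / (a * d)" "trisect_phi q = a * d\<^sup>2 / (b * c)" "gauss_psi q = b\<^sup>2 / a"
    "gauss_phi q = a\<^sup>2 / b" "gauss_psi (q ^ 3) = d\<^sup>2 / c" "gauss_phi (q ^ 3) = c\<^sup>2 / d"
    by (simp_all add: gauss_psi_def gauss_phi_def trisect_psi_def trisect_phi_def a_def b_def c_def d_def flip: power_mult)
  show "trisect_psi q * trisect_phi q = gauss_psi (q ^ 3) * gauss_phi (q ^ 3)"
       "trisect_psi q ^ 3 * gauss_phi q = gauss_phi (q ^ 3) ^ 3 * gauss_psi q"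
    unfolding e using nz by (simp_all add: field_simps eval_nat_numeral)
qed

section \<open>The Euler derivation on the unit disc\<close>

text \<open>The derivation \<open>q d/dq\<close>, which corresponds to \<open>(2 \<pi> i)^(-1) d/d\<tau>\<close> and, in contrast to \<open>d/dq\<close>,
  commutes with \<open>q \<mapsto> q^k\<close> up to the factor \<open>k\<close>.\<close>

definition qD :: "(complex \<Rightarrow> complex) \<Rightarrow> complex \<Rightarrow> complex" where
  "qD f q = q * deriv f q"

abbreviation unit_disc :: "complex set" where
  "unit_disc \<equiv> ball 0 1"

lemma holomorphic_on_dilate:
  assumes "f holomorphic_on unit_disc" "k > 0"
  shows "(\<lambda>q. f (q ^ k)) holomorphic_on unit_disc"
proof -
  have "(f \<circ> (\<lambda>q. q ^ k)) holomorphic_on unit_disc"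
    using norm_power_less_one[OF _ assms(2)]
    by (intro holomorphic_on_compose_gen[OF _ assms(1)]) (auto intro!: holomorphic_intros)
  thus ?thesis by (simp add: o_def)
qed

lemma DERIV_disc: "f holomorphic_on unit_disc \<Longrightarrow> norm q < 1 \<Longrightarrow> (f has_field_derivative deriv f q) (at q)"
  by (rule holomorphic_derivI[of f unit_disc]) auto

lemma qD_holomorphic: "f holomorphic_on unit_disc \<Longrightarrow> qD f holomorphic_on unit_disc"
  unfolding qD_def by (intro holomorphic_intros) auto

lemma qD_cong:
  assumes "\<And>x. norm x < 1 \<Longrightarrow> f x = g x" "norm q < 1"
  shows "qD f q = qD g q"
proof -
  have "eventually (\<lambda>x. x \<in> unit_disc) (nhds q)"
    using assms(2) by (intro eventually_nhds_in_open) auto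
  hence "eventually (\<lambda>x. f x = g x) (nhds q)" by eventually_elim (auto intro: assms(1))
  thus ?thesis unfolding qD_def by (metis deriv_cong_ev)
qed

lemma qD_const [simp]: "qD (\<lambda>x. c) q = 0"
  by (simp add: qD_def)

lemma qD_ident [simp]: "qD (\<lambda>x. x) q = q"
  by (simp add: qD_def)

context
  fixes q :: complex
  assumes q: "norm q < 1"
begin

lemma qD_add:
  assumes "f holomorphic_on unit_disc" "g holomorphic_on unit_disc"
  shows "qD (\<lambda>x. f x + g x) q = qD f q + qD g q"
proof -
  have "((\<lambda>x. f x + g x) has_field_derivative (deriv f q + deriv g q)) (at q)"
    by (intro derivative_intros DERIV_disc assms q)
  thus ?thesis by (simp add: qD_def DERIV_imp_deriv algebra_simps)
qed

lemma qD_diff: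
  assumes "f holomorphic_on unit_disc" "g holomorphic_on unit_disc"
  shows "qD (\<lambda>x. f x - g x) q = qD f q - qD g q"
proof -
  have "((\<lambda>x. f x - g x) has_field_derivative (deriv f q - deriv g q)) (at q)"
    by (intro derivative_intros DERIV_disc assms q)
  thus ?thesis by (simp add: qD_def DERIV_imp_deriv algebra_simps)
qed

lemma qD_mult:
  assumes "f holomorphic_on unit_disc" "g holomorphic_on unit_disc"
  shows "qD (\<lambda>x. f x * g x) q = qD f q * g q + f q * qD g q"
proof -
  have "((\<lambda>x. f x * g x) has_field_derivative (deriv f q * g q + deriv g q * f q)) (at q)"
    by (intro DERIV_mult DERIV_disc assms q)
  thus ?thesis by (simp add: qD_def DERIV_imp_deriv algebra_simps)
qed

lemma qD_power:
  assumes "f holomorphic_on unit_disc"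
  shows "qD (\<lambda>x. f x ^ n) q = of_nat n * f q ^ (n - 1) * qD f q"
proof -
  have "((\<lambda>x. f x ^ n) has_field_derivative (of_nat n * (deriv f q * f q ^ (n - Suc 0)))) (at q)"
    by (intro DERIV_power DERIV_disc assms q)
  thus ?thesis by (simp add: qD_def DERIV_imp_deriv algebra_simps)
qed

lemma qD_divide_const:
  assumes "f holomorphic_on unit_disc"
  shows "qD (\<lambda>x. f x / c) q = qD f q / c"
  using qD_mult[OF assms, of "\<lambda>x. inverse c"] by (simp add: divide_inverse)

lemma qD_dilate:
  assumes "f holomorphic_on unit_disc" "k > 0"
  shows "qD (\<lambda>x. f (x ^ k)) q = of_nat k * qD f (q ^ k)"
proof -
  have "((\<lambda>x. f (x ^ k)) has_field_derivative (deriv f (q ^ k) * (of_nat k * (1 * q ^ (k - Suc 0))))) (at q)"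
    by (rule DERIV_chain2[where f = f])
       (intro DERIV_disc assms norm_power_less_one q DERIV_power DERIV_ident)+
  moreover have "q ^ k = q * q ^ (k - 1)" using assms(2) by (cases k) auto
  ultimately show ?thesis by (simp add: qD_def DERIV_imp_deriv algebra_simps)
qed

end

lemma eta_quotients_holomorphic:
  "gauss_psi holomorphic_on unit_disc" "gauss_phi holomorphic_on unit_disc" "trisect_psi holomorphic_on unit_disc"
proof -
  note h = euler_prod_holomorphic holomorphic_on_dilate[OF euler_prod_holomorphic]
  have nz: "euler_prod q \<noteq> 0" "k > 0 \<Longrightarrow> euler_prod (q ^ k) \<noteq> 0" if "q \<in> unit_disc" for q k
    using that euler_prod_nonzero[of q] euler_prod_power_nonzero[of q k] by auto
  show "gauss_psi holomorphic_on unit_disc" "gauss_phi holomorphic_on unit_disc" "trisect_psi holomorphic_on unit_disc"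
    unfolding gauss_psi_def gauss_phi_def trisect_psi_def by (intro holomorphic_intros h; simp add: nz)+
qed

section \<open>Iterating the cubing of the nome\<close>

text \<open>For the second limit, \<open>9^n q^(3^n) = (m s^m)^2\<close> with \<open>m = 3^n\<close> and \<open>s^2 = q\<close>.\<close>

lemma power_3_power_tendsto_0:
  fixes q :: complex
  assumes "norm q < 1"
  shows "(\<lambda>n. q ^ (3 ^ n)) \<longlonglongrightarrow> 0" "(\<lambda>n. 9 ^ n * q ^ (3 ^ n)) \<longlonglongrightarrow> 0"
proof -
  have f: "filterlim (\<lambda>n. 3 ^ n :: nat) at_top sequentially"
    by (rule filterlim_at_top_mono[OF filterlim_ident]) (auto intro!: always_eventually less_imp_le less_exp)
  show "(\<lambda>n. q ^ (3 ^ n)) \<longlonglongrightarrow> 0"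
    using filterlim_compose[OF LIMSEQ_power_zero[OF assms] f] .
  define s where "s = csqrt q"
  have s: "s\<^sup>2 = q" by (simp add: s_def)
  have "norm s ^ 2 < 1 ^ 2" using assms s by (metis norm_power power_one)
  hence "norm s < 1" by (rule power_less_imp_less_base) auto
  hence "(\<lambda>n. (of_nat n * s ^ n)\<^sup>2) \<longlonglongrightarrow> 0\<^sup>2"
    by (intro tendsto_intros powser_times_n_limit_0)
  from filterlim_compose[OF this f]
  have "(\<lambda>n. (of_nat (3 ^ n) * s ^ (3 ^ n))\<^sup>2) \<longlonglongrightarrow> 0" by simp
  also have "(\<lambda>n. (of_nat (3 ^ n) * s ^ (3 ^ n))\<^sup>2) = (\<lambda>n. 9 ^ n * q ^ (3 ^ n))"
  proof
    fix n
    have "(3 ^ n)\<^sup>2 = (9::complex) ^ n" by (simp add: power2_eq_square flip: power_mult_distrib)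
    moreover have "(s ^ m)\<^sup>2 = q ^ m" for m by (simp add: s[symmetric] mult.commute flip: power_mult)
    ultimately show "(of_nat (3 ^ n) * s ^ (3 ^ n))\<^sup>2 = 9 ^ n * q ^ (3 ^ n)"
      by (simp add: power_mult_distrib)
  qed
  finally show "(\<lambda>n. 9 ^ n * q ^ (3 ^ n)) \<longlonglongrightarrow> 0" .
qed

lemma power_3_invariant_const:
  fixes R :: "complex \<Rightarrow> complex"
  assumes cont: "isCont R 0" and inv: "\<And>q. norm q < 1 \<Longrightarrow> q \<noteq> 0 \<Longrightarrow> R q = R (q ^ 3)"
    and q: "norm q < 1"
  shows "R q = R 0"
proof (cases "q = 0")
  case False
  have "R q = R (q ^ (3 ^ n))" for n
  proof (induction n)
    case (Suc n)
    have "R (q ^ 3 ^ n) = R ((q ^ 3 ^ n) ^ 3)"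
      using False q by (intro inv norm_power_less_one) auto
    thus ?case using Suc by (simp add: mult.commute flip: power_mult)
  qed simp
  moreover have "(\<lambda>n. R (q ^ (3 ^ n))) \<longlonglongrightarrow> R 0"
    using isCont_tendsto_compose[OF cont power_3_power_tendsto_0(1)[OF q]] .
  ultimately show ?thesis by (simp add: LIMSEQ_const_iff)
qed simp

text \<open>Iteration gives \<open>E q = 9^n E (q^(3^n))\<close>.  As \<open>E\<close> vanishes at 0 and is differentiable there, this
  is \<open>9^n q^(3^n)\<close> times a convergent quotient.\<close>

lemma power_3_scaled_eq_0:
  fixes E :: "complex \<Rightarrow> complex"
  assumes diff: "E field_differentiable at 0" and zero: "E 0 = 0"
    and scale: "\<And>q. norm q < 1 \<Longrightarrow> q \<noteq> 0 \<Longrightarrow> E q = 9 * E (q ^ 3)"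
    and q: "norm q < 1"
  shows "E q = 0"
proof (cases "q = 0")
  case False
  obtain e where e: "(E has_field_derivative e) (at 0)"
    using diff by (auto simp: field_differentiable_def)
  hence lim: "(\<lambda>x. E x / x) \<midarrow>0\<rightarrow> e" by (simp add: has_field_derivative_iff zero)
  have "E q = 9 ^ n * E (q ^ (3 ^ n))" for n
  proof (induction n)
    case (Suc n)
    have "E (q ^ 3 ^ n) = 9 * E ((q ^ 3 ^ n) ^ 3)"
      using False q by (intro scale norm_power_less_one) auto
    thus ?case using Suc by (simp add: mult.commute flip: power_mult)
  qed simp
  hence "E q = 9 ^ n * q ^ (3 ^ n) * (E (q ^ (3 ^ n)) / q ^ (3 ^ n))" for n
    using False by simp
  moreover have "(\<lambda>n. 9 ^ n * q ^ (3 ^ n) * (E (q ^ (3 ^ n)) / q ^ (3 ^ n))) \<longlonglongrightarrow> 0 * e"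
  proof (intro tendsto_mult power_3_power_tendsto_0 q)
    have "filterlim (\<lambda>n. q ^ (3 ^ n)) (at 0) sequentially"
      using False power_3_power_tendsto_0(1)[OF q] by (simp add: filterlim_at)
    from filterlim_compose[OF lim this]
    show "(\<lambda>n. E (q ^ (3 ^ n)) / q ^ (3 ^ n)) \<longlonglongrightarrow> e" .
  qed
  ultimately show ?thesis by (simp add: LIMSEQ_const_iff)
qed (simp add: zero)

section \<open>The hauptmodul and its exceptional values\<close>

text \<open>The eta quotient \<open>g\<close> of the main result as a function of the nome \<open>q\<close>.\<close>

definition hauptmodul :: "complex \<Rightarrow> complex" where
  "hauptmodul q = q * gauss_psi (q ^ 3) ^ 4 / gauss_psi q ^ 4"

definition weight_two :: "complex \<Rightarrow> complex" where
  "weight_two q = gauss_phi q ^ 2 * gauss_phi (q ^ 3) ^ 2"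

definition logderiv_psi :: "complex \<Rightarrow> complex" where
  "logderiv_psi q = qD gauss_psi q / gauss_psi q"

lemma modular_functions_holomorphic:
  "hauptmodul holomorphic_on unit_disc" "weight_two holomorphic_on unit_disc"
  "logderiv_psi holomorphic_on unit_disc"
  unfolding hauptmodul_def weight_two_def logderiv_psi_def
  by (intro holomorphic_intros eta_quotients_holomorphic holomorphic_on_dilate qD_holomorphic;
      use eta_quotients_nonzero(1) in simp)+

lemma holomorphic_on_divide_const:
  "f holomorphic_on unit_disc \<Longrightarrow> (\<lambda>q. f q / c) holomorphic_on unit_disc"
  unfolding divide_inverse by (intro holomorphic_intros)

lemmas disc_holomorphic_rules = holomorphic_on_divide_const holomorphic_on_add holomorphic_on_diff holomorphic_on_mult holomorphic_on_power
  holomorphic_on_const holomorphic_on_ident modular_functions_holomorphic eta_quotients_holomorphic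
  modular_functions_holomorphic(1)[THEN holomorphic_on_dilate, of 3, simplified]
  modular_functions_holomorphic(3)[THEN holomorphic_on_dilate, of 3, simplified]
  eta_quotients_holomorphic(1)[THEN holomorphic_on_dilate, of 3, simplified]
  eta_quotients_holomorphic(2)[THEN holomorphic_on_dilate, of 3, simplified]

lemmas qD_rules = qD_divide_const qD_mult qD_power qD_add qD_diff disc_holomorphic_rules

lemma qD_gauss_psi: "norm q < 1 \<Longrightarrow> qD gauss_psi q = gauss_psi q * logderiv_psi q"
  using eta_quotients_nonzero by (simp add: logderiv_psi_def)

lemma gauss_psi_dilate: "norm q < 1 \<Longrightarrow> k > 0 \<Longrightarrow> gauss_psi (q ^ k) \<noteq> 0"
  using eta_quotients_nonzero(1)[OF norm_power_less_one] .

lemma hauptmodul_times: "norm q < 1 \<Longrightarrow> hauptmodul q * gauss_psi q ^ 4 = q * gauss_psi (q ^ 3) ^ 4"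
  using eta_quotients_nonzero(1) by (simp add: hauptmodul_def)

lemma qD_hauptmodul_log:
  assumes q: "norm q < 1"
  shows "qD hauptmodul q = hauptmodul q * (1 + 12 * logderiv_psi (q ^ 3) - 4 * logderiv_psi q)"
proof -
  note h = modular_functions_holomorphic eta_quotients_holomorphic
  have q3: "norm (q ^ 3) < 1" using norm_power_less_one[OF q] by simp
  define a b G u v where "a = gauss_psi q" and "b = gauss_psi (q ^ 3)" and "G = hauptmodul q"
    and "u = logderiv_psi q" and "v = logderiv_psi (q ^ 3)"
  have "qD (\<lambda>x. hauptmodul x * gauss_psi x ^ 4) q = qD (\<lambda>x. x * gauss_psi (x ^ 3) ^ 4) q"
    using hauptmodul_times by (intro qD_cong q)
  moreover have "qD (\<lambda>x. hauptmodul x * gauss_psi x ^ 4) q = qD hauptmodul q * a ^ 4 + G * (4 * a ^ 3 * (a * u))"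
    unfolding a_def G_def u_def using q
    by (simp add: qD_rules qD_gauss_psi)
  moreover have "qD (\<lambda>x. x * gauss_psi (x ^ 3) ^ 4) q = q * b ^ 4 + q * (4 * b ^ 3 * (3 * (b * v)))"
    unfolding b_def v_def using q q3
    by (simp add: qD_rules qD_gauss_psi qD_dilate[of q gauss_psi 3])
  moreover have "q * b ^ 4 = G * a ^ 4" using hauptmodul_times[OF q] by (simp add: a_def b_def G_def)
  ultimately have "qD hauptmodul q * a ^ 4 = (G * (1 + 12 * v - 4 * u)) * a ^ 4" by algebra
  moreover have "a \<noteq> 0" using eta_quotients_nonzero[OF q] by (simp add: a_def)
  ultimately show ?thesis by (simp add: G_def u_def v_def)
qed

lemma one_minus_hauptmodul:
  assumes q: "norm q < 1"
  shows "(1 - hauptmodul q) * gauss_psi q ^ 4 = trisect_psi q ^ 3 * gauss_psi (q ^ 3)"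
  using psi_fourth_power[OF q] hauptmodul_times[OF q] by algebra

text \<open>Together with \<open>\<phi>(-q) \<noteq> 0\<close> and \<open>G \<noteq> 1\<close> this shows that the value 1/9 is avoided.  Both fourth-power identities
  enter, linked by \<open>f(q, q^2) f(-q, -q^5) = \<psi>(q^3) \<phi>(-q^3)\<close>.\<close>

lemma phi_ratio_hauptmodul:
  assumes q: "norm q < 1"
  shows "gauss_phi q ^ 4 * (1 - hauptmodul q) = gauss_phi (q ^ 3) ^ 4 * (1 - 9 * hauptmodul q)"
proof -
  define a b c d A W G where "a = gauss_psi q" and "b = gauss_psi (q ^ 3)" and "c = gauss_phi q"
    and "d = gauss_phi (q ^ 3)" and "A = trisect_psi q" and "W = trisect_phi q" and "G = hauptmodul q"
  have nz: "a \<noteq> 0" using eta_quotients_nonzero[OF q] by (simp add: a_def)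
  have 1: "(1 - G) * a ^ 4 = A ^ 3 * b" "G * a ^ 4 = q * b ^ 4" "A * W = b * d"
    "d ^ 4 - c ^ 4 = 8 * q * d * W ^ 3"
    using one_minus_hauptmodul[OF q] hauptmodul_times[OF q] eta_quotient_relations(1)[OF q]
      phi_fourth_power[OF q]
    by (simp_all add: a_def b_def c_def d_def A_def W_def G_def)
  have "(A * W) ^ 3 = (b * d) ^ 3" using 1 by simp
  hence "((d ^ 4 - c ^ 4) * (1 - G)) * a ^ 4 = (8 * G * d ^ 4) * a ^ 4" using 1 by algebra
  hence "(d ^ 4 - c ^ 4) * (1 - G) = 8 * G * d ^ 4" using nz by simp
  hence "c ^ 4 * (1 - G) = d ^ 4 * (1 - 9 * G)" by algebra
  thus ?thesis by (simp add: c_def d_def G_def)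
qed

lemma hauptmodul_avoids:
  assumes q: "norm q < 1"
  shows "1 - hauptmodul q \<noteq> 0" "1 - 9 * hauptmodul q \<noteq> 0"
proof -
  have nz: "gauss_psi q \<noteq> 0" "trisect_psi q \<noteq> 0" "gauss_psi (q ^ 3) \<noteq> 0" "gauss_phi q \<noteq> 0"
    using eta_quotients_nonzero[OF q] gauss_psi_dilate[OF q] by auto
  show 1: "1 - hauptmodul q \<noteq> 0" using one_minus_hauptmodul[OF q] nz by auto
  show "1 - 9 * hauptmodul q \<noteq> 0" using phi_ratio_hauptmodul[OF q] nz 1 by auto
qed

text \<open>Expresses \<open>M^2\<close> by \<open>G\<close> and \<open>q \<psi>(q)^8\<close>.  Since the logarithmic derivative of the latter is \<open>4 B\<close>,
  this is what makes \<open>DM\<close> a function of \<open>G\<close>, \<open>M\<close> and \<open>B\<close>.\<close>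

lemma weight_two_squared:
  assumes q: "norm q < 1"
  shows "hauptmodul q * weight_two q ^ 2 =
         q * gauss_psi q ^ 8 * (1 - hauptmodul q)\<^sup>2 * (1 - 9 * hauptmodul q)\<^sup>2"
proof -
  define a b c d A G where "a = gauss_psi q" and "b = gauss_psi (q ^ 3)" and "c = gauss_phi q"
    and "d = gauss_phi (q ^ 3)" and "A = trisect_psi q" and "G = hauptmodul q"
  have nz: "a \<noteq> 0" "d \<noteq> 0"
    using eta_quotients_nonzero[OF q] eta_quotients_nonzero[OF norm_power_less_one[OF q, of 3]] by (simp_all add: a_def d_def)
  have 1: "(1 - G) * a ^ 4 = A ^ 3 * b" "G * a ^ 4 = q * b ^ 4" "c ^ 4 * (1 - G) = d ^ 4 * (1 - 9 * G)"
      "A ^ 3 * c = d ^ 3 * a"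
    using one_minus_hauptmodul[OF q] hauptmodul_times[OF q] eta_quotient_relations(2)[OF q]
      phi_ratio_hauptmodul[OF q]
    by (simp_all add: a_def b_def c_def d_def A_def G_def)
  have p: "((1 - G) * a ^ 4) ^ 4 * c ^ 4 = (d ^ 3 * a) ^ 4 * b ^ 4"
    unfolding 1(1) 1(4)[symmetric] by (simp add: power_mult_distrib mult_ac)
  have r: "(c ^ 4 * (1 - G)) ^ 2 = (d ^ 4 * (1 - 9 * G)) ^ 2" using 1 by simp
  \<comment> \<open>Multiplying by \<open>d^8 a^8\<close> clears the denominators left after \<open>1 - G\<close> and \<open>1 - 9G\<close> are replaced
      by their product formulas.\<close>
  have "(q * a ^ 8 * (1 - G)\<^sup>2 * (1 - 9 * G)\<^sup>2) * (d ^ 8 * a ^ 8) =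
        q * c ^ 4 * (((1 - G) * a ^ 4) ^ 4 * c ^ 4)"
    using r by algebra
  also have "\<dots> = (q * b ^ 4) * c ^ 4 * d ^ 12 * a ^ 4" unfolding p by algebra
  also have "\<dots> = (G * (c\<^sup>2 * d\<^sup>2)\<^sup>2) * (d ^ 8 * a ^ 8)" unfolding 1(2)[symmetric] by algebra
  finally have "G * (c\<^sup>2 * d\<^sup>2)\<^sup>2 = q * a ^ 8 * (1 - G)\<^sup>2 * (1 - 9 * G)\<^sup>2"
    using nz by simp
  thus ?thesis by (simp add: weight_two_def a_def c_def d_def G_def)
qed

lemma phi_eighth_powers:
  assumes q: "norm q < 1"
  shows "gauss_phi q ^ 8 * (1 - hauptmodul q) = weight_two q ^ 2 * (1 - 9 * hauptmodul q)"
    and "gauss_phi (q ^ 3) ^ 8 * (1 - 9 * hauptmodul q) = weight_two q ^ 2 * (1 - hauptmodul q)"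
  using phi_ratio_hauptmodul[OF q] unfolding weight_two_def by algebra+

lemma weight_two_nonzero: "norm q < 1 \<Longrightarrow> weight_two q \<noteq> 0"
  using eta_quotients_nonzero(2)[of q] eta_quotients_nonzero(2)[OF norm_power_less_one[of q 3]] by (simp add: weight_two_def)

lemma hauptmodul_nonzero: "norm q < 1 \<Longrightarrow> q \<noteq> 0 \<Longrightarrow> hauptmodul q \<noteq> 0"
  using eta_quotients_nonzero(1)[of q] gauss_psi_dilate[of q 3] by (simp add: hauptmodul_def)

section \<open>The logarithmic derivative of the hauptmodul\<close>

definition logderiv_hauptmodul :: "complex \<Rightarrow> complex" where
  "logderiv_hauptmodul q = 1 + 12 * logderiv_psi (q ^ 3) - 4 * logderiv_psi q"

text \<open>A common parameter for \<open>G(q)\<close> and \<open>G(q^3)\<close>: by the trisection, \<open>\<psi>(q) = f(q^3, q^6) (1 + T)\<close> when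
  \<open>T\<close> denotes this function.\<close>

definition cubic_param :: "complex \<Rightarrow> complex" where
  "cubic_param q = q * gauss_psi (q ^ 9) / trisect_psi (q ^ 3)"

lemma cubic_param_holomorphic: "cubic_param holomorphic_on unit_disc"
  unfolding cubic_param_def
  by (intro holomorphic_intros eta_quotients_holomorphic holomorphic_on_dilate)
     (use eta_quotients_nonzero(3)[OF norm_power_less_one] in auto)

lemma cubic_param_relations:
  assumes q: "norm q < 1"
  shows "1 + cubic_param q \<noteq> 0"
    and "1 + cubic_param q ^ 3 \<noteq> 0"
    and "hauptmodul q * (1 + cubic_param q) ^ 4 = cubic_param q * (1 + cubic_param q ^ 3)"
    and "hauptmodul (q ^ 3) * (1 + cubic_param q ^ 3) = cubic_param q ^ 3"
    and "weight_two q = (1 - 2 * cubic_param q)\<^sup>2 * weight_two (q ^ 3)"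
proof -
  have q3: "norm (q ^ 3) < 1" and q9: "norm (q ^ 9) < 1" using norm_power_less_one[OF q] by simp_all
  define a b c A W T where "a = gauss_psi q" and "b = gauss_psi (q ^ 3)" and "c = gauss_psi (q ^ 9)"
    and "A = trisect_psi (q ^ 3)" and "W = trisect_phi (q ^ 3)" and "T = cubic_param q"
  define d e f where "d = gauss_phi q" and "e = gauss_phi (q ^ 3)" and "f = gauss_phi (q ^ 9)"
  have nz: "a \<noteq> 0" "b \<noteq> 0" "c \<noteq> 0" "A \<noteq> 0"
    using eta_quotients_nonzero[OF q] eta_quotients_nonzero[OF q3] eta_quotients_nonzero[OF q9] by (simp_all add: a_def b_def c_def A_def)
  have T: "T * A = q * c" using nz by (simp add: T_def cubic_param_def c_def A_def)
  have aT: "a = A * (1 + T)"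
    using psi_trisection[OF q] T by (simp add: a_def c_def A_def algebra_simps)
  have "b ^ 4 - q ^ 3 * c ^ 4 = A ^ 3 * c"
    using psi_fourth_power[OF q3] by (simp add: b_def c_def A_def flip: power_mult)
  moreover have "q ^ 3 * c ^ 3 = T ^ 3 * A ^ 3" using T by algebra
  ultimately have bT: "b ^ 4 = A ^ 3 * c * (1 + T ^ 3)" by algebra
  show "1 + cubic_param q \<noteq> 0" using aT nz by (auto simp: T_def)
  show "1 + cubic_param q ^ 3 \<noteq> 0" using bT nz by (auto simp: T_def)
  have "(hauptmodul q * (1 + T) ^ 4) * A ^ 4 = (T * (1 + T ^ 3)) * A ^ 4"
    using hauptmodul_times[OF q, folded a_def b_def] unfolding bT aT using T by algebra
  thus "hauptmodul q * (1 + cubic_param q) ^ 4 = cubic_param q * (1 + cubic_param q ^ 3)"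
    using nz by (simp add: T_def)
  have "hauptmodul (q ^ 3) * b ^ 4 = q ^ 3 * c ^ 4"
    using hauptmodul_times[OF q3] by (simp add: b_def c_def flip: power_mult)
  hence "(hauptmodul (q ^ 3) * (1 + T ^ 3)) * (A ^ 3 * c) = T ^ 3 * (A ^ 3 * c)"
    unfolding bT using \<open>q ^ 3 * c ^ 3 = T ^ 3 * A ^ 3\<close> by algebra
  thus "hauptmodul (q ^ 3) * (1 + cubic_param q ^ 3) = cubic_param q ^ 3"
    using nz by (simp add: T_def)
  have "A * W = c * f"
    using eta_quotient_relations(1)[OF q3] by (simp add: A_def W_def c_def f_def flip: power_mult)
  moreover have "d = f - 2 * q * W" using phi_trisection[OF q] by (simp add: d_def f_def W_def)
  ultimately have "d * A = (f * (1 - 2 * T)) * A" using T by algebra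
  hence "d = f * (1 - 2 * T)" using nz by simp
  moreover have "weight_two q = d\<^sup>2 * e\<^sup>2" "weight_two (q ^ 3) = e\<^sup>2 * f\<^sup>2"
    by (simp_all add: weight_two_def d_def e_def f_def flip: power_mult)
  ultimately show "weight_two q = (1 - 2 * cubic_param q)\<^sup>2 * weight_two (q ^ 3)"
    by (simp add: T_def power_mult_distrib)
qed

text \<open>Differentiate the two expressions \<open>G(q) (1 + T)^4 = T (1 + T^3)\<close> and \<open>G(q^3) (1 + T^3) = T^3\<close> and
  eliminate \<open>DT\<close>.  The resulting factor is the one that relates \<open>M(q)\<close> to \<open>M(q^3)\<close>.\<close>

lemma logderiv_hauptmodul_cubic:
  assumes q: "norm q < 1" "q \<noteq> 0"
  shows "logderiv_hauptmodul q = (1 - 2 * cubic_param q)\<^sup>2 * logderiv_hauptmodul (q ^ 3)"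
proof -
  have q3: "norm (q ^ 3) < 1" using norm_power_less_one[OF q(1)] by simp
  define T t G H L M where "T = cubic_param q" and "t = qD cubic_param q" and "G = hauptmodul q"
    and "H = hauptmodul (q ^ 3)" and "L = logderiv_hauptmodul q" and "M = logderiv_hauptmodul (q ^ 3)"
  note h = disc_holomorphic_rules cubic_param_holomorphic
  have nz: "1 + T \<noteq> 0" "1 + T ^ 3 \<noteq> 0" "T \<noteq> 0"
    using cubic_param_relations(1,2)[OF q(1)] eta_quotients_nonzero[OF q3] gauss_psi_dilate[OF q(1)] q(2)
    by (auto simp: T_def cubic_param_def)
  have D: "qD hauptmodul q = G * L" "qD hauptmodul (q ^ 3) = H * M"
    using qD_hauptmodul_log[OF q(1)] qD_hauptmodul_log[OF q3]
    by (simp_all add: G_def H_def L_def M_def logderiv_hauptmodul_def)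
  have 0: "G * (1 + T) ^ 4 = T * (1 + T ^ 3)" "H * (1 + T ^ 3) = T ^ 3"
    using cubic_param_relations(3,4)[OF q(1)] by (simp_all add: G_def H_def T_def)
  have "qD (\<lambda>x. hauptmodul x * (1 + cubic_param x) ^ 4) q = qD (\<lambda>x. cubic_param x * (1 + cubic_param x ^ 3)) q"
    using cubic_param_relations(3) by (intro qD_cong q)
  hence 1: "G * L * (1 + T) ^ 4 + G * (4 * (1 + T) ^ 3 * t) = t * (1 + T ^ 3) + T * (3 * T\<^sup>2 * t)"
    using q by (simp add: qD_rules h D T_def t_def G_def)
  have "qD (\<lambda>x. hauptmodul (x ^ 3) * (1 + cubic_param x ^ 3)) q = qD (\<lambda>x. cubic_param x ^ 3) q"
    using cubic_param_relations(4) by (intro qD_cong q)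
  hence 2: "3 * (H * M) * (1 + T ^ 3) + H * (3 * T\<^sup>2 * t) = 3 * T\<^sup>2 * t"
    using q by (simp add: qD_rules h D T_def t_def H_def qD_dilate[of q hauptmodul 3])
  have "(3 * T\<^sup>2) * (T * M * (1 + T ^ 3)) = (3 * T\<^sup>2) * t" using 2 0(2) by algebra
  hence t: "t = T * M * (1 + T ^ 3)" using nz by simp
  have "(T * (1 + T ^ 3) * (1 + T)\<^sup>2) * L = (T * (1 + T ^ 3) * (1 + T)\<^sup>2) * ((1 - 2 * T)\<^sup>2 * M)"
    using 1 0(1) unfolding t by algebra
  hence "L = (1 - 2 * T)\<^sup>2 * M" using nz by simp
  thus ?thesis by (simp add: L_def M_def T_def)
qed

lemma logderiv_psi_0 [simp]: "logderiv_psi 0 = 0"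
  by (simp add: logderiv_psi_def qD_def)

lemma gauss_phi_0 [simp]: "gauss_phi 0 = 1"
  by (simp add: gauss_phi_def)

lemma isCont_0_disc: "f holomorphic_on unit_disc \<Longrightarrow> isCont f 0"
  using DERIV_disc[of f 0] DERIV_isCont by fastforce

text \<open>The quotient of the two sides is invariant under \<open>q \<mapsto> q^3\<close> and equals 1 at \<open>q = 0\<close>.\<close>

theorem logderiv_hauptmodul_eq_weight_two:
  assumes q: "norm q < 1"
  shows "logderiv_hauptmodul q = weight_two q"
proof -
  define R where "R x = logderiv_hauptmodul x / weight_two x" for x
  have "R q = R 0"
  proof (rule power_3_invariant_const[OF _ _ q])
    show "isCont R 0"
      unfolding R_def logderiv_hauptmodul_def
      by (intro isCont_0_disc holomorphic_on_divide)
         (auto simp: disc_holomorphic_rules weight_two_nonzero)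
    fix x :: complex
    assume x: "norm x < 1" "x \<noteq> 0"
    have "weight_two x \<noteq> 0" using weight_two_nonzero x by blast
    hence "1 - 2 * cubic_param x \<noteq> 0" using cubic_param_relations(5)[OF x(1)] by auto
    thus "R x = R (x ^ 3)"
      using cubic_param_relations(5)[OF x(1)] logderiv_hauptmodul_cubic[OF x] by (simp add: R_def)
  qed
  thus ?thesis using weight_two_nonzero[OF q]
    by (simp add: R_def logderiv_hauptmodul_def weight_two_def)
qed

corollary qD_hauptmodul:
  assumes "norm q < 1"
  shows "qD hauptmodul q = hauptmodul q * weight_two q"
  using qD_hauptmodul_log[OF assms] logderiv_hauptmodul_eq_weight_two[OF assms]
  by (simp add: logderiv_hauptmodul_def)

section \<open>Closing the differential system\<close>

text \<open>The logarithmic derivative \<open>B\<close> of the weight-one form \<open>q^(1/4) \<psi>(q)^2 = \<eta>(2\<tau>)^4 / \<eta>(\<tau>)^2\<close>.\<close>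

definition logderiv_weight_one :: "complex \<Rightarrow> complex" where
  "logderiv_weight_one q = 1 / 4 + 2 * logderiv_psi q"

lemma logderiv_weight_one_holomorphic: "logderiv_weight_one holomorphic_on unit_disc"
  unfolding logderiv_weight_one_def by (simp add: disc_holomorphic_rules)

text \<open>The logarithmic derivative of \<open>G M^2 = q \<psi>^8 (1 - G)^2 (1 - 9G)^2\<close>, in which \<open>q \<psi>^8\<close>
  contributes \<open>4 B\<close>.\<close>

lemma qD_weight_two:
  assumes q: "norm q < 1"
  shows "qD weight_two q = weight_two q * (2 * logderiv_weight_one q - weight_two q *
     (1 / 2 + hauptmodul q / (1 - hauptmodul q) + 9 * hauptmodul q / (1 - 9 * hauptmodul q)))"
    (is "?l q = ?r q")
proof -
  have main: "?l q = ?r q" if q: "norm q < 1" "q \<noteq> 0" for q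
  proof -
    define G M m B u v a where "G = hauptmodul q" and "M = weight_two q" and "m = qD weight_two q"
      and "B = logderiv_weight_one q" and "u = 1 - G" and "v = 1 - 9 * G" and "a = gauss_psi q"
    have nz: "G \<noteq> 0" "M \<noteq> 0" "u \<noteq> 0" "v \<noteq> 0"
      using hauptmodul_nonzero[OF q] weight_two_nonzero[OF q(1)] hauptmodul_avoids[OF q(1)]
      by (simp_all add: G_def M_def u_def v_def)
    have D: "qD hauptmodul q = G * M" "qD gauss_psi q = a * ((B - 1 / 4) / 2)"
      using qD_hauptmodul[OF q(1)] qD_gauss_psi[OF q(1)] by (simp_all add: G_def M_def a_def B_def logderiv_weight_one_def)
    have "qD (\<lambda>x. hauptmodul x * weight_two x ^ 2) q =
      qD (\<lambda>x. x * gauss_psi x ^ 8 * (1 - hauptmodul x)\<^sup>2 * (1 - 9 * hauptmodul x)\<^sup>2) q"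
      using weight_two_squared by (intro qD_cong q)
    hence 1: "G * M * M\<^sup>2 + G * (2 * M * m) =
       ((q * a ^ 8 + q * (8 * a ^ 7 * (a * ((B - 1 / 4) / 2)))) * u\<^sup>2 + q * a ^ 8 * (2 * u * (- (G * M)))) * v\<^sup>2
       + q * a ^ 8 * u\<^sup>2 * (2 * v * (- (9 * (G * M))))"
      using q by (simp add: qD_rules D u_def v_def flip: G_def M_def m_def a_def)
    define S where "S = q * a ^ 8 * u * v"
    have 2: "G * M\<^sup>2 = S * u * v"
      using weight_two_squared[OF q(1)] by (simp add: G_def M_def S_def a_def u_def v_def power2_eq_square)
    \<comment> \<open>The product \<open>S u v\<close> is the right-hand side of the differentiated relation, so every term of its
      derivative is a multiple of \<open>S\<close>.\<close>
    have 3: "G * M * M\<^sup>2 + G * (2 * M * m) = 4 * B * S * u * v - 2 * S * G * M * v - 18 * S * G * M * u"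
      unfolding 1 S_def by (simp add: field_simps eval_nat_numeral)
    have "(2 * G * M * u * v) * m = (2 * G * M * u * v) * (M * (2 * B - M * (1 / 2 + G / u + 9 * G / v)))"
    proof -
      have "(M * (2 * B - M * (1 / 2 + G / u + 9 * G / v))) * (2 * u * v) =
        M * (4 * B * u * v - M * (u * v + 2 * G * v + 18 * G * u))"
        using nz by (simp add: field_simps)
      hence "(2 * G * M * u * v) * (M * (2 * B - M * (1 / 2 + G / u + 9 * G / v))) =
        G * M\<^sup>2 * (4 * B * u * v - M * (u * v + 2 * G * v + 18 * G * u))" by algebra
      also have "\<dots> = (2 * G * M * u * v) * m"
        using 2 3 by algebra
      finally show ?thesis ..
    qed
    hence "m = M * (2 * B - M * (1 / 2 + G / u + 9 * G / v))" using nz by simp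
    thus ?thesis by (simp add: m_def M_def B_def G_def u_def v_def)
  qed
  show ?thesis
  proof (cases "q = 0")
    case True
    thus ?thesis by (simp add: qD_def logderiv_weight_one_def weight_two_def hauptmodul_def)
  qed (use main q in blast)
qed

text \<open>Logarithmic differentiation of \<open>G = (w(q^3) / w(q))^2\<close>, where \<open>w = q^(1/4) \<psi>^2\<close>, gives
  \<open>3 B(q^3) = B(q) + M(q)/2\<close>.  Differentiating once more compares \<open>DB - B^2\<close> at \<open>q\<close> with 9 times its
  value at \<open>q^3\<close>; expressed by \<open>G\<close> and \<open>M\<close>, the discrepancy is the one between the corresponding
  terms \<open>\<phi>^8/16\<close>.\<close>

theorem qD_logderiv_weight_one:
  assumes q: "norm q < 1"
  shows "qD logderiv_weight_one q = logderiv_weight_one q ^ 2 - gauss_phi q ^ 8 / 16"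
proof -
  define E where "E x = qD logderiv_weight_one x - logderiv_weight_one x ^ 2 + gauss_phi x ^ 8 / 16" for x
  have "E q = 0"
  proof (rule power_3_scaled_eq_0[OF _ _ _ q])
    have "E holomorphic_on unit_disc"
      unfolding E_def by (intro holomorphic_intros logderiv_weight_one_holomorphic eta_quotients_holomorphic qD_holomorphic) auto
    thus "E field_differentiable at 0"
      using holomorphic_on_imp_differentiable_at by (metis centre_in_ball open_ball zero_less_one)
    show "E 0 = 0" by (simp add: E_def qD_def logderiv_weight_one_def power2_eq_square)
    fix x :: complex
    assume x: "norm x < 1" "x \<noteq> 0"
    have x3: "norm (x ^ 3) < 1" using norm_power_less_one[OF x(1)] by simp
    define G M B u v where "G = hauptmodul x" and "M = weight_two x"
      and "B = logderiv_weight_one x" and "u = 1 - G" and "v = 1 - 9 * G"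
    have nz: "u \<noteq> 0" "v \<noteq> 0" using hauptmodul_avoids[OF x(1)] by (simp_all add: u_def v_def G_def)
    have rel: "3 * logderiv_weight_one (y ^ 3) = logderiv_weight_one y + weight_two y / 2" if "norm y < 1" for y
      by (simp add: logderiv_hauptmodul_def logderiv_weight_one_def field_simps
            flip: logderiv_hauptmodul_eq_weight_two[OF that])
    have "qD (\<lambda>y. 3 * logderiv_weight_one (y ^ 3)) x = qD (\<lambda>y. logderiv_weight_one y + weight_two y / 2) x"
      using rel by (intro qD_cong x) auto
    hence "9 * qD logderiv_weight_one (x ^ 3) = qD logderiv_weight_one x + qD weight_two x / 2"
      using x logderiv_weight_one_holomorphic holomorphic_on_dilate[OF logderiv_weight_one_holomorphic, of 3]
      by (simp add: qD_rules qD_dilate[of x logderiv_weight_one 3])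
    moreover have "qD weight_two x = M * (2 * B - M * (1 / 2 + G / u + 9 * G / v))"
      using qD_weight_two[OF x(1)] by (simp add: M_def G_def B_def u_def v_def)
    ultimately have d: "9 * qD logderiv_weight_one (x ^ 3) = qD logderiv_weight_one x + M * (2 * B - M * (1 / 2 + G / u + 9 * G / v)) / 2"
      by simp
    have p: "gauss_phi x ^ 8 = M\<^sup>2 * v / u" "gauss_phi (x ^ 3) ^ 8 = M\<^sup>2 * u / v"
      using phi_eighth_powers[OF x(1)] nz by (simp_all add: G_def M_def u_def v_def field_simps)
    have b: "logderiv_weight_one (x ^ 3) = (B + M / 2) / 3" by (simp add: B_def M_def flip: rel[OF x(1)])
    have "9 * E (x ^ 3) - E x = M * (2 * B - M * (1 / 2 + G / u + 9 * G / v)) / 2 - (B + M / 2)\<^sup>2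
       + B\<^sup>2 + 9 * (M\<^sup>2 * u / v) / 16 - (M\<^sup>2 * v / u) / 16"
      unfolding E_def p b using d by (simp add: B_def power_divide algebra_simps)
    also have "\<dots> = M\<^sup>2 * (- 8 * u * v - 8 * G * v - 72 * G * u + 9 * u * u - v * v) / (16 * u * v)"
      using nz by (simp add: field_simps power2_eq_square)
    also have "- 8 * u * v - 8 * G * v - 72 * G * u + 9 * u * u - v * v = 0"
      unfolding u_def v_def by algebra
    finally show "E x = 9 * E (x ^ 3)" by simp
  qed
  thus ?thesis by (simp add: E_def algebra_simps)
qed

text \<open>With \<open>DDG = (DG) Y\<close> one has \<open>DDDG = (DG) (Y^2 + DY)\<close>, so the Schwarzian is \<open>DY - Y^2/2\<close>.  The point
  \<open>q = 0\<close> is the cusp where \<open>G = 0\<close>.\<close>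

theorem hauptmodul_schwarzian:
  assumes q: "norm q < 1" "q \<noteq> 0"
  defines "G \<equiv> hauptmodul q"
  shows "(qD ^^ 3) hauptmodul q / qD hauptmodul q - 3 / 2 * ((qD ^^ 2) hauptmodul q / qD hauptmodul q)\<^sup>2
     + (81 * G ^ 4 - 108 * G ^ 3 + 102 * G\<^sup>2 - 12 * G + 1) / (2 * (9 * G - 1)\<^sup>2 * (G - 1)\<^sup>2 * G\<^sup>2)
       * (qD hauptmodul q)\<^sup>2 = 0"
proof -
  \<comment> \<open>Names for the two inverses keep all derivatives polynomial.\<close>
  define r s where "r x = inverse (1 - hauptmodul x)" and "s x = inverse (1 - 9 * hauptmodul x)" for x
  define Y where "Y x = 2 * logderiv_weight_one x + weight_two x / 2 - hauptmodul x * weight_two x * (r x + 9 * s x)" for x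
  have hr: "r holomorphic_on unit_disc" and hs: "s holomorphic_on unit_disc"
    unfolding r_def s_def using hauptmodul_avoids by (intro holomorphic_intros modular_functions_holomorphic; simp)+
  note h = disc_holomorphic_rules logderiv_weight_one_holomorphic hr hs
  have hY: "Y holomorphic_on unit_disc" unfolding Y_def by (simp add: h)
  have rs: "r x * (1 - hauptmodul x) = 1" "s x * (1 - 9 * hauptmodul x) = 1" if "norm x < 1" for x
    using hauptmodul_avoids[OF that] by (simp_all add: r_def s_def)
  have DG: "qD hauptmodul x = hauptmodul x * weight_two x" if "norm x < 1" for x
    using qD_hauptmodul[OF that] .
  have DM: "qD weight_two x = weight_two x * (Y x - weight_two x)" if "norm x < 1" for x
  proof -
    have "hauptmodul x / (1 - hauptmodul x) = hauptmodul x * r x"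
         "9 * hauptmodul x / (1 - 9 * hauptmodul x) = 9 * hauptmodul x * s x"
      by (simp_all add: r_def s_def divide_inverse)
    thus ?thesis using qD_weight_two[OF that] by (simp add: Y_def algebra_simps)
  qed
  have DDG: "qD (qD hauptmodul) x = hauptmodul x * weight_two x * Y x" if "norm x < 1" for x
  proof -
    have "qD (qD hauptmodul) x = qD (\<lambda>x. hauptmodul x * weight_two x) x"
      using DG that by (intro qD_cong)
    also have "\<dots> = hauptmodul x * weight_two x * Y x"
      using that by (simp add: qD_rules DG DM algebra_simps)
    finally show ?thesis .
  qed
  define M B R S where "M = weight_two q" and "B = logderiv_weight_one q" and "R = r q" and "S = s q"
  have RS: "R * (1 - G) = 1" "S * (1 - 9 * G) = 1" using rs[OF q(1)] by (simp_all add: R_def S_def G_def)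
  have Dr: "qD r q = R\<^sup>2 * G * M"
  proof -
    have "qD (\<lambda>x. r x * (1 - hauptmodul x)) q = qD (\<lambda>x. 1) q"
      using rs q by (intro qD_cong)
    hence "qD r q * (1 - G) = R * (G * M)"
      using q by (simp add: qD_rules h DG flip: G_def M_def R_def)
    thus ?thesis using RS by algebra
  qed
  have Ds: "qD s q = 9 * S\<^sup>2 * G * M"
  proof -
    have "qD (\<lambda>x. s x * (1 - 9 * hauptmodul x)) q = qD (\<lambda>x. 1) q"
      using rs q by (intro qD_cong)
    hence "qD s q * (1 - 9 * G) = S * (9 * (G * M))"
      using q by (simp add: qD_rules h DG flip: G_def M_def S_def)
    thus ?thesis using RS by algebra
  qed
  have DB: "qD logderiv_weight_one q = B\<^sup>2 - M\<^sup>2 * (1 - 9 * G) * R / 16"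
  proof -
    have "gauss_phi q ^ 8 = M\<^sup>2 * (1 - 9 * G) * R"
      using phi_eighth_powers(1)[OF q(1)] RS(1) unfolding M_def G_def by algebra
    thus ?thesis using qD_logderiv_weight_one[OF q(1)] by (simp add: B_def)
  qed
  define y where "y = Y q"
  have y: "y = 2 * B + M / 2 - G * M * (R + 9 * S)"
    by (simp add: y_def Y_def B_def M_def G_def R_def S_def)
  define y' where "y' = 2 * (B\<^sup>2 - M\<^sup>2 * (1 - 9 * G) * R / 16) + M * (y - M) / 2
      - (G * M * M + G * (M * (y - M))) * (R + 9 * S) - G * M * (R\<^sup>2 * G * M + 9 * (9 * S\<^sup>2 * G * M))"
  have DY: "qD Y q = y'"
  proof -
    have "qD Y q = qD (\<lambda>x. 2 * logderiv_weight_one x + weight_two x / 2 - hauptmodul x * weight_two x * (r x + 9 * s x)) q"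
      using q by (intro qD_cong) (simp_all add: Y_def)
    also have "\<dots> = y'"
      using q unfolding y'_def
      by (simp add: qD_rules h DG DM DB Dr Ds flip: G_def M_def R_def S_def y_def)
    finally show ?thesis .
  qed
  have DDDG: "qD (qD (qD hauptmodul)) q = G * M * (y\<^sup>2 + y')"
  proof -
    have "qD (qD (qD hauptmodul)) q = qD (\<lambda>x. hauptmodul x * weight_two x * Y x) q"
      using DDG q by (intro qD_cong)
    also have "\<dots> = G * M * (y\<^sup>2 + y')"
      using q by (simp add: qD_rules h hY DG DM DY flip: G_def M_def y_def) (simp add: algebra_simps power2_eq_square)
    finally show ?thesis .
  qed
  have nz: "G \<noteq> 0" "M \<noteq> 0" "1 - G \<noteq> 0" "1 - 9 * G \<noteq> 0"
    using hauptmodul_nonzero[OF q] weight_two_nonzero[OF q(1)] hauptmodul_avoids[OF q(1)]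
    by (simp_all add: G_def M_def)
  have num: "(qD ^^ 3) hauptmodul q = G * M * (y\<^sup>2 + y')" "(qD ^^ 2) hauptmodul q = G * M * y"
     "qD hauptmodul q = G * M"
    using DDDG DDG[OF q(1)] DG[OF q(1)] by (simp_all add: eval_nat_numeral G_def M_def y_def)
  define P where "P = 81 * G ^ 4 - 108 * G ^ 3 + 102 * G\<^sup>2 - 12 * G + 1"
  have "2 * y' - y\<^sup>2 + P * M\<^sup>2 * (R\<^sup>2 * S\<^sup>2) = 0"
  proof -
    \<comment> \<open>All terms that contain \<open>B\<close> cancel here.\<close>
    have "2 * y' - y\<^sup>2 = M\<^sup>2 * (- (1 - 9 * G) * R / 4 - 3 / 4 + (G * (R + 9 * S))\<^sup>2 - G * (R + 9 * S)
       - 2 * G\<^sup>2 * (R\<^sup>2 + 81 * S\<^sup>2))"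
      unfolding y'_def y by (simp add: field_simps power2_eq_square)
    moreover have "4 * (- (1 - 9 * G) * R / 4 - 3 / 4 + (G * (R + 9 * S))\<^sup>2 - G * (R + 9 * S)
       - 2 * G\<^sup>2 * (R\<^sup>2 + 81 * S\<^sup>2)) = - 4 * P * (R\<^sup>2 * S\<^sup>2)"
    proof -
      \<comment> \<open>Every monomial in \<open>R\<close> and \<open>S\<close> is brought to the common factor \<open>R\<^sup>2 S\<^sup>2 = 1 / (u\<^sup>2 v\<^sup>2)\<close>.\<close>
      define Z u v where "Z = R\<^sup>2 * S\<^sup>2" and "u = 1 - G" and "v = 1 - 9 * G"
      have "R * u = 1" "S * v = 1" using RS by (simp_all add: u_def v_def)
      hence e: "R = Z * (u * v\<^sup>2)" "S = Z * (u\<^sup>2 * v)" "1 = Z * (u\<^sup>2 * v\<^sup>2)" "R * S = Z * (u * v)"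
          "R\<^sup>2 = Z * v\<^sup>2" "S\<^sup>2 = Z * u\<^sup>2"
        unfolding Z_def by algebra+
      have "4 * (- (1 - 9 * G) * R / 4 - 3 / 4 + (G * (R + 9 * S))\<^sup>2 - G * (R + 9 * S)
         - 2 * G\<^sup>2 * (R\<^sup>2 + 81 * S\<^sup>2)) = - v * R - 3 * 1 + 4 * G\<^sup>2 * (R\<^sup>2 + 18 * (R * S) + 81 * S\<^sup>2)
         - 4 * G * R - 36 * G * S - 8 * G\<^sup>2 * R\<^sup>2 - 648 * G\<^sup>2 * S\<^sup>2"
        unfolding v_def by (simp add: field_simps power2_eq_square)
      also have "\<dots> = - v * (Z * (u * v\<^sup>2)) - 3 * (Z * (u\<^sup>2 * v\<^sup>2)) +
          4 * G\<^sup>2 * (Z * v\<^sup>2 + 18 * (Z * (u * v)) + 81 * (Z * u\<^sup>2))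
         - 4 * G * (Z * (u * v\<^sup>2)) - 36 * G * (Z * (u\<^sup>2 * v)) - 8 * G\<^sup>2 * (Z * v\<^sup>2) - 648 * G\<^sup>2 * (Z * u\<^sup>2)"
        by (simp only: e(5,6) e(4) e(1)[symmetric] e(2)[symmetric] e(3)[symmetric])
      also have "\<dots> = - 4 * P * Z" unfolding P_def u_def v_def by algebra
      finally show ?thesis by (simp only: Z_def)
    qed
    ultimately show ?thesis by algebra
  qed
  moreover have "R\<^sup>2 * S\<^sup>2 = 1 / ((9 * G - 1)\<^sup>2 * (G - 1)\<^sup>2)"
  proof -
    have "(R\<^sup>2 * S\<^sup>2) * ((9 * G - 1)\<^sup>2 * (G - 1)\<^sup>2) = 1" using RS by algebra
    moreover have "(9 * G - 1)\<^sup>2 * (G - 1)\<^sup>2 \<noteq> 0" using nz by simp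
    ultimately show ?thesis by (simp add: eq_divide_eq)
  qed
  ultimately have key: "2 * y' - y\<^sup>2 + P * M\<^sup>2 / ((9 * G - 1)\<^sup>2 * (G - 1)\<^sup>2) = 0"
    by (simp add: mult.assoc)
  define u v where "u = (9 * G - 1)\<^sup>2" and "v = (G - 1)\<^sup>2"
  have 1: "G * M * (y\<^sup>2 + y') / (G * M) = y\<^sup>2 + y'" "G * M * y / (G * M) = y"
    using nz by simp_all
  have "P / (2 * u * v * G\<^sup>2) * (G * M)\<^sup>2 = P * M\<^sup>2 / (u * v) / 2"
    using nz by (simp add: power_mult_distrib)
  hence "(y\<^sup>2 + y') - 3 / 2 * y\<^sup>2 + P / (2 * u * v * G\<^sup>2) * (G * M)\<^sup>2 =
         (2 * y' - y\<^sup>2 + P * M\<^sup>2 / (u * v)) / 2"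
    by (simp add: diff_divide_distrib add_divide_distrib)
  also have "\<dots> = 0" unfolding u_def v_def key by simp
  finally have "(y\<^sup>2 + y') - 3 / 2 * y\<^sup>2 + P / (2 * u * v * G\<^sup>2) * (G * M)\<^sup>2 = 0" .
  thus ?thesis unfolding num 1 P_def u_def v_def .
qed

section \<open>Return to the upper half-plane\<close>

abbreviation nome :: "complex \<Rightarrow> complex" where
  "nome t \<equiv> exp (2 * of_real pi * \<i> * t)"

lemma nome_in_disc: "Im t > 0 \<Longrightarrow> norm (nome t) < 1"
  by (simp add: norm_exp_eq_Re)

lemma higher_deriv_nome:
  assumes f: "f holomorphic_on unit_disc" and g: "\<And>t. Im t > 0 \<Longrightarrow> g t = f (nome t)"
    and t: "Im t > 0"
  shows "(deriv ^^ n) g t = (2 * of_real pi * \<i>) ^ n * (qD ^^ n) f (nome t)"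
  using t
proof (induction n arbitrary: t)
  case (Suc n)
  have hol: "(qD ^^ n) f holomorphic_on unit_disc"
    by (induction n) (auto intro: f qD_holomorphic)
  have "eventually (\<lambda>s. s \<in> {s. Im s > 0}) (nhds t)"
    using Suc.prems by (intro eventually_nhds_in_open open_halfspace_Im_gt) auto
  hence "eventually (\<lambda>s. (deriv ^^ n) g s = (2 * of_real pi * \<i>) ^ n * (qD ^^ n) f (nome s)) (nhds t)"
    by eventually_elim (use Suc.IH in auto)
  hence "deriv ((deriv ^^ n) g) t = deriv (\<lambda>s. (2 * of_real pi * \<i>) ^ n * (qD ^^ n) f (nome s)) t"
    by (intro deriv_cong_ev) auto
  also have "\<dots> = (2 * of_real pi * \<i>) ^ n * (deriv ((qD ^^ n) f) (nome t) * (nome t * (2 * of_real pi * \<i>)))"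
    by (rule DERIV_imp_deriv, rule DERIV_cmult, rule DERIV_chain2[where g = "\<lambda>s. nome s", OF DERIV_disc[OF hol nome_in_disc[OF Suc.prems]]])
       (auto intro!: derivative_eq_intros)
  finally show ?case by (simp add: qD_def[of "(qD ^^ n) f"] mult_ac)
qed (simp add: g)

lemma dedekind_eta_nome:
  "dedekind_eta (of_nat m * t) = exp (2 * of_real pi * \<i> * t / 24) ^ m * euler_prod (nome t ^ m)"
proof -
  have "exp (2 * of_real pi * \<i> * of_nat (Suc n) * (of_nat m * t)) = (nome t ^ m) ^ Suc n" for n
    unfolding exp_of_nat_mult[symmetric] by (simp add: algebra_simps)
  moreover have "exp (2 * of_real pi * \<i> * (of_nat m * t) / 24) = exp (2 * of_real pi * \<i> * t / 24) ^ m"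
    unfolding exp_of_nat_mult[symmetric] by (simp add: algebra_simps)
  ultimately show ?thesis by (simp add: dedekind_eta_def euler_prod_def del: of_nat_Suc power_Suc)
qed

text \<open>The exponential prefactors combine to a single \<open>q\<close>, because
  \<open>4 + 6 * 8 - 2 * 8 - 3 * 4 = 24\<close>.\<close>

lemma eta_quotient_hauptmodul:
  assumes "Im t > 0"
  shows "dedekind_eta t ^ 4 * dedekind_eta (6 * t) ^ 8 / (dedekind_eta (2 * t) ^ 8 * dedekind_eta (3 * t) ^ 4)
         = hauptmodul (nome t)"
proof -
  define q z where "q = nome t" and "z = exp (2 * of_real pi * \<i> * t / 24)"
  have q: "norm q < 1" unfolding q_def by (rule nome_in_disc[OF assms])
  have zq: "z ^ 24 = q" unfolding z_def q_def exp_of_nat_mult[symmetric] by (simp add: mult_ac)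
  define a b c d where "a = euler_prod q" and "b = euler_prod (q\<^sup>2)" and "c = euler_prod (q ^ 3)"
    and "d = euler_prod (q ^ 6)"
  have nz: "a \<noteq> 0" "b \<noteq> 0" "c \<noteq> 0" "d \<noteq> 0" "z \<noteq> 0"
    using euler_prod_nonzero[OF q] euler_prod_power_nonzero[OF q]
    by (auto simp: a_def b_def c_def d_def z_def)
  have e: "dedekind_eta t = z * a" "dedekind_eta (2 * t) = z\<^sup>2 * b" "dedekind_eta (3 * t) = z ^ 3 * c"
      "dedekind_eta (6 * t) = z ^ 6 * d"
    using dedekind_eta_nome[of 1 t] dedekind_eta_nome[of 2 t] dedekind_eta_nome[of 3 t] dedekind_eta_nome[of 6 t]
    by (simp_all add: z_def a_def b_def c_def d_def q_def)
  have h: "hauptmodul q = z ^ 24 * (d\<^sup>2 / c) ^ 4 / (b\<^sup>2 / a) ^ 4"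
    unfolding hauptmodul_def gauss_psi_def zq by (simp add: a_def b_def c_def d_def flip: power_mult)
  have "(z * a) ^ 4 * (z ^ 6 * d) ^ 8 / ((z\<^sup>2 * b) ^ 8 * (z ^ 3 * c) ^ 4) =
      z ^ 24 * (d\<^sup>2 / c) ^ 4 / (b\<^sup>2 / a) ^ 4"
    using nz by (simp add: field_simps)
  thus ?thesis unfolding e h[symmetric] q_def .
qed

theorem theorem9p1:
  fixes g :: "complex \<Rightarrow> complex" and \<tau> :: complex
  assumes g: "\<And>t. Im t > 0 \<Longrightarrow>
      g t = dedekind_eta t ^ 4 * dedekind_eta (6 * t) ^ 8 /
            (dedekind_eta (2 * t) ^ 8 * dedekind_eta (3 * t) ^ 4)"
    and "Im \<tau> > 0"
  shows "schwarzian g \<tau> +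
      (81 * g \<tau> ^ 4 - 108 * g \<tau> ^ 3 + 102 * g \<tau> ^ 2 - 12 * g \<tau> + 1) /
      (2 * (9 * g \<tau> - 1) ^ 2 * (g \<tau> - 1) ^ 2 * g \<tau> ^ 2) * (deriv g \<tau>) ^ 2 = 0"
proof -
  define q K :: complex where "q = nome \<tau>" and "K = 2 * of_real pi * \<i>"
  have q: "norm q < 1" "q \<noteq> 0" using nome_in_disc[OF assms(2)] by (simp_all add: q_def)
  have K: "K \<noteq> 0" by (simp add: K_def)
  have gh: "g t = hauptmodul (nome t)" if "Im t > 0" for t
    using g[OF that] eta_quotient_hauptmodul[OF that] by simp
  have d: "(deriv ^^ n) g \<tau> = K ^ n * (qD ^^ n) hauptmodul q" for n
    unfolding K_def q_def by (rule higher_deriv_nome[OF modular_functions_holomorphic(1) gh assms(2)])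
  define x y z where "x = qD hauptmodul q" and "y = (qD ^^ 2) hauptmodul q" and "z = (qD ^^ 3) hauptmodul q"
  have D: "deriv g \<tau> = K * x" "(deriv ^^ 2) g \<tau> = K\<^sup>2 * y" "(deriv ^^ 3) g \<tau> = K ^ 3 * z"
    using d[of 1] d[of 2] d[of 3] by (simp_all add: x_def y_def z_def)
  have "schwarzian g \<tau> = K\<^sup>2 * (z / x - 3 / 2 * (y / x)\<^sup>2)"
    unfolding schwarzian_def D using K
    by (cases "x = 0") (simp_all add: field_simps eval_nat_numeral)
  define c where "c = (81 * g \<tau> ^ 4 - 108 * g \<tau> ^ 3 + 102 * g \<tau> ^ 2 - 12 * g \<tau> + 1) /
      (2 * (9 * g \<tau> - 1) ^ 2 * (g \<tau> - 1) ^ 2 * g \<tau> ^ 2)"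
  have "z / x - 3 / 2 * (y / x)\<^sup>2 + c * x\<^sup>2 = 0"
    using hauptmodul_schwarzian[OF q]
    unfolding c_def gh[OF assms(2)] q_def[symmetric] x_def y_def z_def .
  hence "K\<^sup>2 * (z / x - 3 / 2 * (y / x)\<^sup>2 + c * x\<^sup>2) = 0" by simp
  hence "K\<^sup>2 * (z / x - 3 / 2 * (y / x)\<^sup>2) + c * (K * x)\<^sup>2 = 0"
    by (simp only: power_mult_distrib distrib_left mult.left_commute)
  thus ?thesis unfolding c_def[symmetric] D \<open>schwarzian g \<tau> = _\<close> .
qed

end
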